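(* Let $\Phi:H_m\to H_n$ be a quantum channel and let $1\le\alpha<2$. Then \[ S_{\min,\alpha}(\Phi)\geq g_\alpha\left(\|\Phi\|_{1\to2}^2\right), \] and equality holds when $n=2$.
   Context: $H_n$ denotes the real space of $n\times n$ Hermitian matrices and $H_{n,+,1}$ the set of density matrices. A quantum channel is a completely positive trace-preserving linear map. $\|\Phi\|_{1\to2}=\max_{0\neq\rho\in H_m}\|\Phi(\rho)\|_2/\|\rho\|_1$, which for a channel equals $\max_{\rho\in H_{m,+,1}}\|\Phi(\rho)\|_2$. The Rényi entropy is $S_\alpha(\sigma)=\frac1{1-\alpha}\log{\rm Tr}\,\sigma^\alpha$ ($S_1$ is the von Neumann entropy $-{\rm Tr}\,\sigma\log\sigma$), and $S_{\min,\alpha}(\Phi)=\min_{\rho\in H_{m,+,1}}S_\alpha(\Phi(\rho))$. For $c\in(0,1]$ let $k=\lfloor 1/c\rfloor$ and $\Delta=\sqrt{c-(1-c)/k}$, and define $g_\alpha(c)=\frac{1}{1-\alpha}\log\left(k\left(\frac{1+\Delta}{1+k}\right)^\alpha+\left(\frac{1-k\Delta}{1+k}\right)^\alpha\right)$ for $1<\alpha<2$, and $g_1(c)=\log(k+1)-\frac{1}{1+k}\left[k(1+\Delta)\log(1+\Delta)+(1-k\Delta)\log(1-k\Delta)\right]$ (with $0\log 0=0$). *)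

theory Defs
  imports "Jordan_Normal_Form.Jordan_Normal_Form"
begin

definition mtrace :: "complex mat \<Rightarrow> complex" where
  "mtrace A = (\<Sum>i<dim_row A. A $$ (i,i))"

definition hermitian_mat :: "nat \<Rightarrow> complex mat \<Rightarrow> bool" where
  "hermitian_mat n A \<longleftrightarrow> A \<in> carrier_mat n n \<and>
     (\<forall>i<n. \<forall>j<n. A $$ (i,j) = cnj (A $$ (j,i)))"

definition psd_mat :: "nat \<Rightarrow> complex mat \<Rightarrow> bool" where
  "psd_mat n A \<longleftrightarrow> hermitian_mat n A \<and>
     (\<forall>v \<in> carrier_vec n. 0 \<le> Re (\<Sum>i<n. cnj (v $ i) * (A *\<^sub>v v) $ i))"

definition density_mats :: "nat \<Rightarrow> complex mat set" where
  "density_mats n = {\<rho>. psd_mat n \<rho> \<and> mtrace \<rho> = 1}"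

definition eigvals :: "complex mat \<Rightarrow> complex list" where
  "eigvals A = (SOME es. length es = dim_row A \<and>
                  char_poly A = (\<Prod>e\<leftarrow>es. [:- e, 1:]))"

definition trace_norm :: "complex mat \<Rightarrow> real" where
  "trace_norm A = sum_list (map cmod (eigvals A))"

definition frob_norm :: "complex mat \<Rightarrow> real" where
  "frob_norm A = sqrt (\<Sum>i<dim_row A. \<Sum>j<dim_col A. (cmod (A $$ (i,j)))^2)"

text \<open>Applying Phi blockwise to a (k*m)x(k*m) matrix, i.e. id_k tensor Phi.\<close>
definition block_apply :: "nat \<Rightarrow> nat \<Rightarrow> nat \<Rightarrow> (complex mat \<Rightarrow> complex mat) \<Rightarrow> complex mat \<Rightarrow> complex mat" where
  "block_apply k m n \<Phi> M = mat (k*n) (k*n) (\<lambda>(p,q).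
      \<Phi> (mat m m (\<lambda>(i,j). M $$ ((p div n) * m + i, (q div n) * m + j))) $$ (p mod n, q mod n))"

definition quantum_channel :: "nat \<Rightarrow> nat \<Rightarrow> (complex mat \<Rightarrow> complex mat) \<Rightarrow> bool" where
  "quantum_channel m n \<Phi> \<longleftrightarrow>
     (\<forall>A \<in> carrier_mat m m. \<Phi> A \<in> carrier_mat n n) \<and>
     (\<forall>A \<in> carrier_mat m m. \<forall>B \<in> carrier_mat m m. \<Phi> (A + B) = \<Phi> A + \<Phi> B) \<and>
     (\<forall>A \<in> carrier_mat m m. \<forall>c::complex. \<Phi> (c \<cdot>\<^sub>m A) = c \<cdot>\<^sub>m \<Phi> A) \<and>
     (\<forall>A \<in> carrier_mat m m. mtrace (\<Phi> A) = mtrace A) \<and>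
     (\<forall>k. \<forall>M. psd_mat (k*m) M \<longrightarrow> psd_mat (k*n) (block_apply k m n \<Phi> M))"

definition norm_1_2 :: "nat \<Rightarrow> (complex mat \<Rightarrow> complex mat) \<Rightarrow> real" where
  "norm_1_2 m \<Phi> = Sup {frob_norm (\<Phi> \<rho>) / trace_norm \<rho> | \<rho>. hermitian_mat m \<rho> \<and> \<rho> \<noteq> 0\<^sub>m m m}"

definition xlogx :: "real \<Rightarrow> real" where
  "xlogx x = (if x = 0 then 0 else x * ln x)"

definition renyi :: "real \<Rightarrow> complex mat \<Rightarrow> real" where
  "renyi \<alpha> \<sigma> = (if \<alpha> = 1 then - sum_list (map (\<lambda>e. xlogx (Re e)) (eigvals \<sigma>))
      else ln (sum_list (map (\<lambda>e. (Re e) powr \<alpha>) (eigvals \<sigma>))) / (1 - \<alpha>))"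

definition min_renyi :: "nat \<Rightarrow> real \<Rightarrow> (complex mat \<Rightarrow> complex mat) \<Rightarrow> real" where
  "min_renyi m \<alpha> \<Phi> = (INF \<rho> \<in> density_mats m. renyi \<alpha> (\<Phi> \<rho>))"

definition g_fun :: "real \<Rightarrow> real \<Rightarrow> real" where
  "g_fun \<alpha> c = (let k = real (nat \<lfloor>1 / c\<rfloor>); \<Delta> = sqrt (c - (1 - c) / k) in
     if \<alpha> = 1 then
       ln (k + 1) - (1 / (1 + k)) * (k * xlogx (1 + \<Delta>) + xlogx (1 - k * \<Delta>))
     else
       ln (k * ((1 + \<Delta>) / (1 + k)) powr \<alpha> + ((1 - k * \<Delta>) / (1 + k)) powr \<alpha>) / (1 - \<alpha>))"

end

theory Submission
  imports
    "HOL-Analysis.Henstock_Kurzweil_Integration"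
    "HOL-Analysis.L2_Norm"
    "HOL-Real_Asymp.Real_Asymp"
    "Jordan_Normal_Form.Schur_Decomposition"
    Defs
begin

text \<open>
  On \<open>[0, 1]\<close> and up to a positive factor, a multiple of \<open>t\<close> and a non-negative multiple of \<open>t\<^sup>2\<close>, both
  \<open>t powr \<alpha>\<close> with \<open>1 < \<alpha> < 2\<close> and \<open>t * ln t\<close> are mixtures, with weight \<open>s powr (\<alpha> - 3)\<close>, of the
  truncated squares \<open>\<phi>\<^sub>s\<close>, which agree with \<open>t\<^sup>2\<close> on \<open>t \<le> s\<close> and continue along the tangent
  beyond \<open>s\<close>. Among probability vectors whose
  squares sum to at most \<open>c\<close>, one vector maximises the sum of \<open>\<phi>\<^sub>s\<close> for every \<open>s\<close> at once: \<open>k\<close> equal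
  entries \<open>x\<close> and one smaller entry \<open>y\<close>. Its entropy is \<open>g_fun \<alpha> c\<close>, so no monotonicity of
  \<open>g_fun\<close> is needed. The spectrum of \<open>\<Phi> \<rho>\<close> is such a vector with \<open>c = (norm_1_2 m \<Phi>)\<^sup>2\<close>. For \<open>n = 2\<close> the
  entropy is a continuous function of the purity, and the purities of channel outputs approach \<open>c\<close>,
  because by the spectral decomposition and the triangle inequality the norm is already
  the supremum over density matrices.
\<close>

subsection \<open>Truncated squares and the entropy functions\<close>

text \<open>In \<open>t\<close> the second derivative is 2 below \<open>s\<close> and 0 above it, so
  a mixture with weight \<open>w\<close> has as second derivative twice the \<open>w\<close>-mass of
  the \<open>s\<close> above \<open>t\<close>.\<close>

definition trunc_sq :: "real \<Rightarrow> real \<Rightarrow> real" where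
  "trunc_sq s t = (if t \<le> s then t\<^sup>2 else 2 * s * t - s\<^sup>2)"

text \<open>The integrand is \<open>w s * (2 * s * t - s^2)\<close> up to \<open>s = t\<close> and
  \<open>w s * t^2\<close> beyond, so \<open>a\<close> and \<open>b\<close> serve the first piece
  and \<open>e\<close>, a tail mass up to a constant, the second. The bracket
  \<open>2 * t * a t - b t + t^2 * e t\<close> collects the boundary terms at \<open>t\<close>; its
  second derivative is \<open>2 * e t\<close>, which shows the weight that a given function
  requires.\<close>

lemma trunc_sq_weight_integral:
  fixes a b e w :: "real \<Rightarrow> real"
  assumes a: "\<And>s. 0 < s \<Longrightarrow> (a has_real_derivative w s * s) (at s)"
    and b: "\<And>s. 0 < s \<Longrightarrow> (b has_real_derivative w s * s\<^sup>2) (at s)"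
    and e: "\<And>s. 0 < s \<Longrightarrow> (e has_real_derivative - w s) (at s)"
    and "0 < \<epsilon>" "\<epsilon> \<le> t" "t \<le> 1"
  shows "((\<lambda>s. w s * trunc_sq s t) has_integral
           (2 * t * a t - b t + t\<^sup>2 * e t) - t\<^sup>2 * e 1 - (2 * t * a \<epsilon> - b \<epsilon>)) {\<epsilon>..1}"
proof -
  have 1: "((\<lambda>s. w s * trunc_sq s t) has_integral
      (2 * t * a t - b t) - (2 * t * a \<epsilon> - b \<epsilon>)) {\<epsilon>..t}"
  proof (rule has_integral_eq)
    show "((\<lambda>s. 2 * t * (w s * s) - w s * s\<^sup>2) has_integral
      (2 * t * a t - b t) - (2 * t * a \<epsilon> - b \<epsilon>)) {\<epsilon>..t}"
      using assms(4,5)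
      by (intro fundamental_theorem_of_calculus)
        (auto simp flip: has_real_derivative_iff_has_vector_derivative
          intro!: derivative_eq_intros DERIV_subset[OF a] DERIV_subset[OF b])
  qed (auto simp: trunc_sq_def algebra_simps power2_eq_square)
  have 2: "((\<lambda>s. w s * trunc_sq s t) has_integral (- t\<^sup>2 * e 1) - (- t\<^sup>2 * e t)) {t..1}"
  proof (rule has_integral_eq)
    show "((\<lambda>s. - t\<^sup>2 * (- w s)) has_integral (- t\<^sup>2 * e 1) - (- t\<^sup>2 * e t)) {t..1}"
      using assms(4-6)
      by (intro fundamental_theorem_of_calculus)
        (auto simp flip: has_real_derivative_iff_has_vector_derivative
          intro!: derivative_eq_intros DERIV_subset[OF e])
  qed (auto simp: trunc_sq_def algebra_simps power2_eq_square)
  show ?thesis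
    using has_integral_combine[OF assms(5,6) 1 2] by (simp add: algebra_simps)
qed

text \<open>
  The function \<open>a\<close> may diverge at 0, as \<open>ln\<close> does: the integrals start at \<open>\<epsilon> > 0\<close> and
  their terms \<open>2 * t * a \<epsilon>\<close> cancel because \<open>p\<close> and \<open>q\<close> have the same sum.
\<close>

lemma sum_le_if_trunc_sq_sum_le:
  fixes a b e w F :: "real \<Rightarrow> real" and p :: "'i \<Rightarrow> real" and q :: "'j \<Rightarrow> real"
  assumes a: "\<And>s. 0 < s \<Longrightarrow> (a has_real_derivative w s * s) (at s)"
    and b: "\<And>s. 0 < s \<Longrightarrow> (b has_real_derivative w s * s\<^sup>2) (at s)"
    and e: "\<And>s. 0 < s \<Longrightarrow> (e has_real_derivative - w s) (at s)"
    and w: "\<And>s. 0 < s \<Longrightarrow> 0 \<le> w s"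
    and b0: "(b \<longlongrightarrow> 0) (at_right 0)" and e1: "0 \<le> e 1"
    and F: "\<And>t. 0 < t \<Longrightarrow> F t = 2 * t * a t - b t + t\<^sup>2 * e t" and F0: "F 0 = 0"
    and fin: "finite I" "finite J"
    and p: "\<And>i. i \<in> I \<Longrightarrow> 0 \<le> p i" "\<And>i. i \<in> I \<Longrightarrow> p i \<le> 1"
    and q: "\<And>j. j \<in> J \<Longrightarrow> 0 \<le> q j" "\<And>j. j \<in> J \<Longrightarrow> q j \<le> 1"
    and eq: "sum p I = sum q J"
    and le: "\<And>s. 0 < s \<Longrightarrow> s \<le> 1 \<Longrightarrow> (\<Sum>i\<in>I. trunc_sq s (p i)) \<le> (\<Sum>j\<in>J. trunc_sq s (q j))"
  shows "(\<Sum>i\<in>I. F (p i)) \<le> (\<Sum>j\<in>J. F (q j))"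
proof -
  \<comment> \<open>Once \<open>\<epsilon>\<close> is below every positive entry, each positive
    entry leaves one boundary term \<open>b \<epsilon>\<close> and each zero entry none, hence the
    cardinality. The family is general so that the fact serves both \<open>p\<close> and
    \<open>q\<close>.\<close>
  have int: "((\<lambda>s. w s * (\<Sum>i\<in>K. trunc_sq s (r i))) has_integral
      (\<Sum>i\<in>K. F (r i)) - e 1 * (\<Sum>i\<in>K. (r i)\<^sup>2) - 2 * a \<epsilon> * sum r K
        + of_nat (card {i\<in>K. 0 < r i}) * b \<epsilon>) {\<epsilon>..1}"
    if "finite K" and r: "\<And>i. i \<in> K \<Longrightarrow> 0 \<le> r i \<and> r i \<le> 1" and "0 < \<epsilon>"
      and \<epsilon>: "\<And>i. i \<in> K \<Longrightarrow> 0 < r i \<Longrightarrow> \<epsilon> \<le> r i"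
    for K and r :: "'k \<Rightarrow> real" and \<epsilon> :: real
  proof -
    have *: "((\<lambda>s. w s * trunc_sq s (r i)) has_integral
        F (r i) - e 1 * (r i)\<^sup>2 - 2 * a \<epsilon> * r i + (if 0 < r i then b \<epsilon> else 0)) {\<epsilon>..1}"
      if i: "i \<in> K" for i
    proof (cases "0 < r i")
      case True
      then show ?thesis
        using trunc_sq_weight_integral[OF a b e \<open>0 < \<epsilon>\<close>, of "r i"] r[OF i] \<epsilon>[OF i True]
        by (simp add: F[OF True] algebra_simps)
    next
      case False
      then have "r i = 0" using r[OF i] by simp
      moreover have "((\<lambda>s. w s * trunc_sq s 0) has_integral 0) {\<epsilon>..1}"
        by (rule has_integral_is_0) (use \<open>0 < \<epsilon>\<close> in \<open>auto simp: trunc_sq_def\<close>)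
      ultimately show ?thesis by (simp add: F0)
    qed
    have "((\<lambda>s. \<Sum>i\<in>K. w s * trunc_sq s (r i)) has_integral
      (\<Sum>i\<in>K. F (r i) - e 1 * (r i)\<^sup>2 - 2 * a \<epsilon> * r i + (if 0 < r i then b \<epsilon> else 0))) {\<epsilon>..1}"
      by (rule has_integral_sum[OF \<open>finite K\<close> *])
    moreover have "(\<Sum>i\<in>K. if 0 < r i then b \<epsilon> else 0) = of_nat (card {i\<in>K. 0 < r i}) * b \<epsilon>"
      using \<open>finite K\<close> by (simp add: sum.If_cases Int_def)
    ultimately show ?thesis
      by (simp add: sum.distrib sum_subtractf sum_distrib_left)
  qed
  have small: "\<forall>\<^sub>F \<epsilon> in at_right 0. \<forall>i\<in>K. 0 < r i \<longrightarrow> \<epsilon> \<le> r i" if "finite K"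
    for K and r :: "'k \<Rightarrow> real"
    unfolding eventually_ball_finite_distrib[OF that]
  proof
    fix i
    show "\<forall>\<^sub>F \<epsilon> in at_right 0. 0 < r i \<longrightarrow> \<epsilon> \<le> r i"
      by (cases "0 < r i") (auto simp: eventually_at_right_field intro!: exI[of _ "r i"])
  qed
  let ?np = "of_nat (card {i\<in>I. 0 < p i}) :: real" and ?nq = "of_nat (card {j\<in>J. 0 < q j}) :: real"
  have ev: "\<forall>\<^sub>F \<epsilon> in at_right 0. (\<Sum>i\<in>I. F (p i)) - e 1 * (\<Sum>i\<in>I. (p i)\<^sup>2) + ?np * b \<epsilon>
       \<le> (\<Sum>j\<in>J. F (q j)) - e 1 * (\<Sum>j\<in>J. (q j)\<^sup>2) + ?nq * b \<epsilon>"
    using small[OF fin(1), of p] small[OF fin(2), of q] eventually_at_right_less[of 0]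
  proof eventually_elim
    case (elim \<epsilon>)
    have "w s * (\<Sum>i\<in>I. trunc_sq s (p i)) \<le> w s * (\<Sum>j\<in>J. trunc_sq s (q j))" if "s \<in> {\<epsilon>..1}" for s
      using that elim le[of s] w[of s] by (intro mult_left_mono) auto
    from has_integral_le[OF int[OF fin(1), of p \<epsilon>] int[OF fin(2), of q \<epsilon>] this]
    show ?case using elim p q eq by auto
  qed
  have "(\<Sum>i\<in>I. F (p i)) - e 1 * (\<Sum>i\<in>I. (p i)\<^sup>2) + ?np * 0
       \<le> (\<Sum>j\<in>J. F (q j)) - e 1 * (\<Sum>j\<in>J. (q j)\<^sup>2) + ?nq * 0"
    by (rule tendsto_le[OF _ _ _ ev]) (intro trivial_limit_at_right_real tendsto_intros b0)+
  \<comment> \<open>At \<open>s = 1\<close> no entry exceeds the truncation point, so the hypothesis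
    compares the sums of squares; with \<open>0 \<le> e 1\<close> this absorbs the terms in
    \<open>e 1\<close>, which appear because the integrals stop at 1.\<close>
  moreover have "(\<Sum>i\<in>I. (p i)\<^sup>2) \<le> (\<Sum>j\<in>J. (q j)\<^sup>2)"
    using le[of 1] p q by (simp add: trunc_sq_def)
  then have "e 1 * (\<Sum>i\<in>I. (p i)\<^sup>2) \<le> e 1 * (\<Sum>j\<in>J. (q j)\<^sup>2)"
    using e1 by (rule mult_left_mono)
  ultimately show ?thesis by simp
qed

lemma sum_powr_le_if_trunc_sq_sum_le:
  fixes p :: "'i \<Rightarrow> real" and q :: "'j \<Rightarrow> real"
  assumes \<alpha>: "1 < \<alpha>" "\<alpha> < 2"
    and "finite I" "finite J"
    and "\<And>i. i \<in> I \<Longrightarrow> 0 \<le> p i" "\<And>i. i \<in> I \<Longrightarrow> p i \<le> 1"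
    and "\<And>j. j \<in> J \<Longrightarrow> 0 \<le> q j" "\<And>j. j \<in> J \<Longrightarrow> q j \<le> 1"
    and "sum p I = sum q J"
    and "\<And>s. 0 < s \<Longrightarrow> s \<le> 1 \<Longrightarrow> (\<Sum>i\<in>I. trunc_sq s (p i)) \<le> (\<Sum>j\<in>J. trunc_sq s (q j))"
  shows "(\<Sum>i\<in>I. p i powr \<alpha>) \<le> (\<Sum>j\<in>J. q j powr \<alpha>)"
proof -
  \<comment> \<open>The factor for which \<open>2 * t * a t - b t + t^2 * e t\<close> is
    \<open>C * t powr \<alpha>\<close> under the weight \<open>s powr (\<alpha> - 3)\<close>; it
    equals \<open>2 / (\<alpha> * (\<alpha> - 1) * (2 - \<alpha>))\<close>.\<close>
  define C where "C = 2 / (\<alpha> - 1) - 1 / \<alpha> + 1 / (2 - \<alpha>)"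
  have "1 / \<alpha> < 2 / (\<alpha> - 1)" using \<alpha> by (simp add: field_simps)
  then have C: "0 < C" using \<alpha> unfolding C_def by (simp add: add_pos_pos)
  have pw: "t * t powr (\<alpha> - 1) = t powr \<alpha>" "t\<^sup>2 * t powr (\<alpha> - 2) = t powr \<alpha>" if "0 < t" for t :: real
    using that by (simp_all add: powr_diff power2_eq_square)
  have pw3: "s powr (\<alpha> - 3) * s = s powr (\<alpha> - 2)" "s powr (\<alpha> - 3) * s\<^sup>2 = s powr (\<alpha> - 1)"
    if "0 < s" for s :: real
    using that powr_add[of s "\<alpha> - 3" 1] powr_add[of s "\<alpha> - 3" 2] by (simp_all add: powr_numeral)
  have "(\<Sum>i\<in>I. C * p i powr \<alpha>) \<le> (\<Sum>j\<in>J. C * q j powr \<alpha>)"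
  proof (rule sum_le_if_trunc_sq_sum_le[where a = "\<lambda>s. s powr (\<alpha> - 1) / (\<alpha> - 1)"
        and b = "\<lambda>s. s powr \<alpha> / \<alpha>" and e = "\<lambda>s. s powr (\<alpha> - 2) / (2 - \<alpha>)"
        and w = "\<lambda>s. s powr (\<alpha> - 3)", OF _ _ _ _ _ _ _ _ assms(3-)])
    fix s :: real assume s: "0 < s"
    show "((\<lambda>s. s powr (\<alpha> - 1) / (\<alpha> - 1)) has_real_derivative s powr (\<alpha> - 3) * s) (at s)"
      unfolding pw3[OF s] using s \<alpha> by (auto intro!: derivative_eq_intros)
    show "((\<lambda>s. s powr \<alpha> / \<alpha>) has_real_derivative s powr (\<alpha> - 3) * s\<^sup>2) (at s)"
      unfolding pw3[OF s] using s \<alpha> by (auto intro!: derivative_eq_intros)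
    show "((\<lambda>s. s powr (\<alpha> - 2) / (2 - \<alpha>)) has_real_derivative - (s powr (\<alpha> - 3))) (at s)"
    proof -
      have "(\<alpha> - 2) * z / (2 - \<alpha>) = - z" for z
        using \<alpha> by (simp add: divide_eq_eq algebra_simps)
      then show ?thesis
        using s \<alpha> by (auto intro!: derivative_eq_intros)
    qed
    show "C * s powr \<alpha> = 2 * s * (s powr (\<alpha> - 1) / (\<alpha> - 1)) - s powr \<alpha> / \<alpha>
        + s\<^sup>2 * (s powr (\<alpha> - 2) / (2 - \<alpha>))"
      using pw[OF s] unfolding C_def by (simp add: algebra_simps add_divide_distrib)
  next
    show "((\<lambda>s. s powr \<alpha> / \<alpha>) \<longlongrightarrow> 0) (at_right 0)"
      using \<alpha> by (auto intro!: tendsto_eq_intros eventually_at_rightI[of 0 1])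
  qed (use \<alpha> in auto)
  then show ?thesis using C by (simp flip: sum_distrib_left)
qed

text \<open>The endpoint \<open>\<alpha> = 1\<close> of the weights is \<open>1 / s^2\<close>: the
  bracket becomes \<open>2 * t * ln t - t + t\<close>, so the linear terms cancel and twice
  \<open>xlogx\<close> remains.\<close>

lemma sum_xlogx_le_if_trunc_sq_sum_le:
  fixes p :: "'i \<Rightarrow> real" and q :: "'j \<Rightarrow> real"
  assumes "finite I" "finite J"
    and "\<And>i. i \<in> I \<Longrightarrow> 0 \<le> p i" "\<And>i. i \<in> I \<Longrightarrow> p i \<le> 1"
    and "\<And>j. j \<in> J \<Longrightarrow> 0 \<le> q j" "\<And>j. j \<in> J \<Longrightarrow> q j \<le> 1"
    and "sum p I = sum q J"
    and "\<And>s. 0 < s \<Longrightarrow> s \<le> 1 \<Longrightarrow> (\<Sum>i\<in>I. trunc_sq s (p i)) \<le> (\<Sum>j\<in>J. trunc_sq s (q j))"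
  shows "(\<Sum>i\<in>I. xlogx (p i)) \<le> (\<Sum>j\<in>J. xlogx (q j))"
proof -
  have "(\<Sum>i\<in>I. 2 * xlogx (p i)) \<le> (\<Sum>j\<in>J. 2 * xlogx (q j))"
  proof (rule sum_le_if_trunc_sq_sum_le[where a = ln and b = "\<lambda>s. s" and e = "\<lambda>s. 1 / s"
        and w = "\<lambda>s. 1 / s\<^sup>2", OF _ _ _ _ _ _ _ _ assms])
    fix s :: real assume s: "0 < s"
    show "(ln has_real_derivative 1 / s\<^sup>2 * s) (at s)"
      using s by (auto intro!: derivative_eq_intros simp: power2_eq_square)
    show "((\<lambda>s. 1 / s) has_real_derivative - (1 / s\<^sup>2)) (at s)"
      using s by (auto intro!: derivative_eq_intros simp: power2_eq_square)
    show "2 * xlogx s = 2 * s * ln s - s + s\<^sup>2 * (1 / s)"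
      using s by (simp add: xlogx_def power2_eq_square)
  qed (auto intro!: derivative_eq_intros tendsto_eq_intros simp: xlogx_def)
  then show ?thesis by (simp flip: sum_distrib_left)
qed

section \<open>Extremal vectors for sums of truncated squares\<close>

text \<open>By convexity, mass capped at \<open>s\<close> per entry has the largest sum of squares
  when \<open>j\<close> entries are full and one entry holds the rest. The induction removes one
  entry \<open>t\<close> and compares it with the rest \<open>d\<close>.\<close>

lemma sum_squares_packing:
  fixes p :: "'i \<Rightarrow> real" and s :: real and j :: nat
  assumes "finite I" and "\<And>i. i \<in> I \<Longrightarrow> 0 \<le> p i" and "\<And>i. i \<in> I \<Longrightarrow> p i \<le> s"
    and "of_nat j * s \<le> sum p I" and "sum p I \<le> of_nat (Suc j) * s"
  shows "(\<Sum>i\<in>I. (p i)\<^sup>2) \<le> of_nat j * s\<^sup>2 + (sum p I - of_nat j * s)\<^sup>2"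
  using assms
proof (induction I arbitrary: j rule: finite_induct)
  case empty
  then show ?case by (auto intro: add_nonneg_nonneg)
next
  case (insert i I)
  define M t where "M = sum p I" and "t = p i"
  define d where "d = M + t - of_nat j * s"
  have t: "0 \<le> t" "t \<le> s" using insert.prems unfolding t_def by auto
  have M: "0 \<le> M" unfolding M_def using insert.prems by (intro sum_nonneg) auto
  have d: "0 \<le> d" "d \<le> s" using insert.prems(3,4) insert.hyps
    unfolding d_def M_def t_def by (auto simp: algebra_simps)
  have IH: "(\<Sum>i\<in>I. (p i)\<^sup>2) \<le> of_nat l * s\<^sup>2 + (M - of_nat l * s)\<^sup>2"
    if "of_nat l * s \<le> M" "M \<le> of_nat (Suc l) * s" for l
    using that insert.IH[of l] insert.prems(1,2) unfolding M_def by simp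
  have "(\<Sum>i\<in>I. (p i)\<^sup>2) + t\<^sup>2 \<le> of_nat j * s\<^sup>2 + d\<^sup>2"
  proof (cases "t \<le> d")
    case True
    \<comment> \<open>Removing \<open>t\<close> shrinks the rest to \<open>d - t\<close> and leaves
      the number of full entries unchanged.\<close>
    have "(\<Sum>i\<in>I. (p i)\<^sup>2) \<le> of_nat j * s\<^sup>2 + (d - t)\<^sup>2"
      using IH[of j] True d t by (simp add: d_def algebra_simps)
    moreover have "(d - t)\<^sup>2 + t\<^sup>2 \<le> d\<^sup>2"
      using True t mult_left_mono[of t d t] by (simp add: power2_eq_square algebra_simps)
    ultimately show ?thesis by simp
  next
    case False
    \<comment> \<open>Here the removal also breaks up a full entry: the others hold
      \<open>j - 1\<close> full entries and a rest \<open>s + d - t\<close>.\<close>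
    have "j \<noteq> 0"
    proof
      assume "j = 0"
      then show False using False M by (simp add: d_def)
    qed
    then obtain l where l: "j = Suc l" by (cases j) auto
    have "(\<Sum>i\<in>I. (p i)\<^sup>2) \<le> of_nat l * s\<^sup>2 + (s + d - t)\<^sup>2"
      using IH[of l] False d t by (simp add: d_def l algebra_simps)
    \<comment> \<open>The pairs \<open>(t, s + d - t)\<close> and \<open>(s, d)\<close> have equal
      sums and the second is more spread out; the product is half the difference of their sums of
      squares.\<close>
    moreover have "0 \<le> (s - t) * (t - d)"
      using False t by (intro mult_nonneg_nonneg) auto
    then have "(s + d - t)\<^sup>2 + t\<^sup>2 \<le> s\<^sup>2 + d\<^sup>2"
      by (simp add: power2_eq_square algebra_simps)
    ultimately show ?thesis by (simp add: l algebra_simps)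
  qed
  then show ?case
    using insert.hyps by (simp add: M_def t_def d_def algebra_simps)
qed

lemma trunc_sq_ge_line: "2 * s * t - s\<^sup>2 \<le> trunc_sq s t"
  using zero_le_power2[of "s - t"] by (simp add: trunc_sq_def power2_eq_square algebra_simps)

lemma trunc_sq_le_square: "trunc_sq s t \<le> t\<^sup>2"
  using zero_le_power2[of "s - t"] by (simp add: trunc_sq_def power2_eq_square algebra_simps)

text \<open>For \<open>x \<le> s\<close> the right-hand side is \<open>c\<close>, which bounds the
  sum of squares. For \<open>s < x\<close> the entries above \<open>s\<close> enter only through
  their number \<open>r\<close> and mass \<open>A\<close>, the others through their sum of squares
  \<open>Out\<close>; the cases decide whether a linear bound on \<open>Out\<close>, the constraint
  \<open>c\<close> or packing is the sharp estimate.\<close>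

lemma sum_trunc_sq_le:
  fixes p :: "'i \<Rightarrow> real" and x y c s :: real and k :: nat
  assumes I: "finite I" and p: "\<And>i. i \<in> I \<Longrightarrow> 0 \<le> p i" and p1: "sum p I = 1"
    and pc: "(\<Sum>i\<in>I. (p i)\<^sup>2) \<le> c"
    and k: "0 < k" and xy: "0 \<le> y" "y \<le> x" "of_nat k * x + y = 1" "of_nat k * x\<^sup>2 + y\<^sup>2 = c"
    and s: "0 < s"
  shows "(\<Sum>i\<in>I. trunc_sq s (p i)) \<le> of_nat k * trunc_sq s x + trunc_sq s y"
proof (cases "x \<le> s")
  case True
  have "(\<Sum>i\<in>I. trunc_sq s (p i)) \<le> (\<Sum>i\<in>I. (p i)\<^sup>2)"
    by (intro sum_mono trunc_sq_le_square)
  then show ?thesis using pc xy True by (simp add: trunc_sq_def)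
next
  case sx: False
  define T where "T = {i\<in>I. s < p i}"
  define r where "r = card T"
  define A where "A = sum p T"
  define L where "L = (\<Sum>i\<in>I. trunc_sq s (p i))"
  have fT: "finite T" "T \<subseteq> I" using I by (auto simp: T_def)
  have out_sum: "sum p (I - T) = 1 - A"
    using sum.subset_diff[OF fT(2) I, of p] p1 by (simp add: A_def)
  have out: "0 \<le> p i" "p i \<le> s" if "i \<in> I - T" for i
    using that p by (auto simp: T_def)
  define Out where "Out = (\<Sum>i\<in>I - T. (p i)\<^sup>2)"
  have L: "L = Out + 2 * s * A - of_nat r * s\<^sup>2"
  proof -
    have "L = (\<Sum>i\<in>I - T. trunc_sq s (p i)) + (\<Sum>i\<in>T. trunc_sq s (p i))"
      unfolding L_def by (rule sum.subset_diff[OF fT(2) I])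
    also have "(\<Sum>i\<in>I - T. trunc_sq s (p i)) = Out"
      unfolding Out_def by (rule sum.cong) (use out in \<open>auto simp: trunc_sq_def\<close>)
    also have "(\<Sum>i\<in>T. trunc_sq s (p i)) = (\<Sum>i\<in>T. 2 * s * p i - s\<^sup>2)"
      by (rule sum.cong) (auto simp: trunc_sq_def T_def)
    also have "\<dots> = 2 * s * A - of_nat r * s\<^sup>2"
      by (simp add: sum_subtractf A_def r_def sum_distrib_left)
    finally show ?thesis by simp
  qed
  have Out_lin: "Out \<le> s * (1 - A)"
  proof -
    have "Out \<le> (\<Sum>i\<in>I - T. s * p i)"
      unfolding Out_def by (rule sum_mono) (use out in \<open>auto simp: power2_eq_square intro: mult_right_mono\<close>)
    then show ?thesis by (simp add: out_sum flip: sum_distrib_left)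
  qed
  have A1: "A \<le> 1" using out_sum sum_nonneg[of "I - T" p] out by simp
  define R where "R = of_nat k * trunc_sq s x + trunc_sq s y"
  have R: "R = of_nat k * (2 * s * x - s\<^sup>2) + trunc_sq s y"
    using sx by (simp add: R_def trunc_sq_def)
  have "of_nat k * x = 1 - y" using xy by simp
  moreover have "of_nat k * (2 * s * x - s\<^sup>2) = 2 * s * (of_nat k * x) - of_nat k * s\<^sup>2"
    by (simp add: algebra_simps)
  ultimately have Reasy: "of_nat k * (2 * s * x - s\<^sup>2) = 2 * s * (1 - y) - of_nat k * s\<^sup>2"
    by simp
  \<comment> \<open>The tangent at \<open>s\<close> lies below \<open>trunc_sq s y\<close>; this
    lower value suffices in the cases that bound \<open>Out\<close> linearly.\<close>
  have R_ge: "2 * s - (of_nat k + 1) * s\<^sup>2 \<le> R"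
    unfolding R Reasy using trunc_sq_ge_line[of s y] by (simp add: algebra_simps)
  have "L \<le> R"
  proof (cases "k + 1 \<le> r")
    case True
    have "L \<le> 2 * s * (1 - A) + 2 * s * A - of_nat r * s\<^sup>2"
    proof -
      have "0 \<le> s * (1 - A)" using s A1 by simp
      then have "Out \<le> 2 * (s * (1 - A))" using Out_lin by linarith
      then show ?thesis by (simp add: L mult.assoc)
    qed
    also have "\<dots> = 2 * s - of_nat r * s\<^sup>2" by (simp add: algebra_simps)
    also have "\<dots> \<le> 2 * s - (of_nat k + 1) * s\<^sup>2"
      using True mult_right_mono[of "of_nat k + 1 :: real" "of_nat r" "s\<^sup>2"] by simp
    finally show ?thesis using R_ge by simp
  next
    case False
    then have rk: "r \<le> k" by simp
    \<comment> \<open>\<open>B\<close> is the mass of the large entries after padding them with copies of \<open>s\<close> up to \<open>k\<close> entries.\<close>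
    define B where "B = A + of_nat (k - r) * s"
    have kr: "of_nat (k - r) = (of_nat k - of_nat r :: real)" using rk by simp
    \<comment> \<open>\<open>1 - B\<close> is the mass left beside the \<open>k\<close> padded
      entries. If it is at least \<open>s\<close>, the linear bound is enough. If the padded entries
      hold at least the mass of \<open>k\<close> copies of \<open>x\<close>, their excess over
      \<open>s\<close> is large and the constraint \<open>c\<close> decides. Otherwise the rest lies
      strictly between \<open>y\<close> and \<open>s\<close>, and packing applies.\<close>
    consider "s \<le> 1 - B" | "1 - B < s" "of_nat k * x \<le> B" | "1 - B < s" "B < of_nat k * x"
      by linarith
    then show ?thesis
    proof cases
      case 1
      have "L \<le> s + s * A - of_nat r * s\<^sup>2"
        unfolding L using Out_lin by (simp add: algebra_simps)
      also have "\<dots> = s + s * (B - (of_nat k - of_nat r) * s) - of_nat r * s\<^sup>2"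
        by (simp add: B_def kr)
      also have "\<dots> = s + s * B - of_nat k * s\<^sup>2"
        by (simp add: algebra_simps power2_eq_square)
      also have "\<dots> \<le> s + s * (1 - s) - of_nat k * s\<^sup>2"
        using 1 s by (simp add: mult_left_mono)
      also have "\<dots> = 2 * s - (of_nat k + 1) * s\<^sup>2"
        by (simp add: algebra_simps power2_eq_square)
      finally show ?thesis using R_ge by simp
    next
      case 2
      \<comment> \<open>Truncation subtracts the squared excesses over \<open>s\<close> from the sum
        of squares, for \<open>p\<close> as for the extremal vector. So the squared excesses on
        \<open>T\<close> must reach \<open>k * u^2\<close>, plus \<open>w^2\<close> when
        \<open>y\<close> exceeds \<open>s\<close>; Cauchy-Schwarz yields this from the total excess
        \<open>B - k * s\<close>.\<close>
      have Q: "(\<Sum>i\<in>T. (p i - s)\<^sup>2) = (\<Sum>i\<in>T. (p i)\<^sup>2) - 2 * s * A + of_nat r * s\<^sup>2"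
      proof -
        have "(\<Sum>i\<in>T. (p i - s)\<^sup>2) = (\<Sum>i\<in>T. (p i)\<^sup>2 - 2 * s * p i + s\<^sup>2)"
          by (rule sum.cong) (auto simp: power2_eq_square algebra_simps)
        then show ?thesis
          by (simp add: sum.distrib sum_subtractf sum_distrib_left A_def r_def)
      qed
      have "Out + (\<Sum>i\<in>T. (p i)\<^sup>2) \<le> c"
        using pc sum.subset_diff[OF fT(2) I, of "\<lambda>i. (p i)\<^sup>2"] by (simp add: Out_def)
      then have L': "L \<le> c - (\<Sum>i\<in>T. (p i - s)\<^sup>2)" unfolding L Q by simp
      have "(\<Sum>i\<in>T. 1 * (p i - s))\<^sup>2 \<le> (\<Sum>i\<in>T. 1\<^sup>2) * (\<Sum>i\<in>T. (p i - s)\<^sup>2)"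
        by (rule Cauchy_Schwarz_ineq_sum)
      then have "(A - of_nat r * s)\<^sup>2 \<le> of_nat r * (\<Sum>i\<in>T. (p i - s)\<^sup>2)"
        by (simp add: sum_subtractf A_def r_def)
      also have "\<dots> \<le> of_nat k * (\<Sum>i\<in>T. (p i - s)\<^sup>2)"
        using rk by (intro mult_right_mono sum_nonneg) auto
      finally have CS: "(B - of_nat k * s)\<^sup>2 \<le> of_nat k * (\<Sum>i\<in>T. (p i - s)\<^sup>2)"
        by (simp add: B_def kr algebra_simps)
      define u where "u = x - s"
      have u: "0 < u" using sx by (simp add: u_def)
      have Bu: "of_nat k * u \<le> B - of_nat k * s" using 2 by (simp add: u_def algebra_simps)
      have cu: "c = of_nat k * (2 * s * x - s\<^sup>2) + of_nat k * u\<^sup>2 + y\<^sup>2"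
        using xy by (simp add: u_def power2_eq_square algebra_simps)
      show ?thesis
      proof (cases "y \<le> s")
        case True
        have "(of_nat k * u)\<^sup>2 \<le> (B - of_nat k * s)\<^sup>2"
          using Bu u by (intro power_mono) auto
        then have "of_nat k * (of_nat k * u\<^sup>2) \<le> of_nat k * (\<Sum>i\<in>T. (p i - s)\<^sup>2)"
          using CS by (simp add: power2_eq_square algebra_simps)
        then have "of_nat k * u\<^sup>2 \<le> (\<Sum>i\<in>T. (p i - s)\<^sup>2)" using k by simp
        then show ?thesis using L' cu True by (simp add: R trunc_sq_def)
      next
        case False
        define w where "w = y - s"
        have w: "0 < w" "w \<le> u" using False xy by (auto simp: w_def u_def)
        \<comment> \<open>Here \<open>1 - B < s\<close> enters: with \<open>k * x + y = 1\<close> it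
          adds \<open>w\<close> to the total excess.\<close>
        have "of_nat k * u + w \<le> B - of_nat k * s"
          using 2 xy by (simp add: u_def w_def algebra_simps)
        then have "(of_nat k * u + w)\<^sup>2 \<le> (B - of_nat k * s)\<^sup>2"
          using u w by (intro power_mono) auto
        moreover have "of_nat k * (of_nat k * u\<^sup>2 + w\<^sup>2) \<le> (of_nat k * u + w)\<^sup>2"
        proof -
          have "of_nat k * (w * w) \<le> of_nat k * (u * w)"
            using w by (intro mult_left_mono mult_right_mono) auto
          moreover have "0 \<le> of_nat k * (u * w)" "0 \<le> w * w" using u w by auto
          ultimately have "of_nat k * (w * w) \<le> 2 * (of_nat k * (u * w)) + w * w" by linarith
          then show ?thesis by (simp add: power2_eq_square algebra_simps)
        qed
        ultimately have "of_nat k * (of_nat k * u\<^sup>2 + w\<^sup>2) \<le> of_nat k * (\<Sum>i\<in>T. (p i - s)\<^sup>2)"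
          using CS by linarith
        then have "of_nat k * u\<^sup>2 + w\<^sup>2 \<le> (\<Sum>i\<in>T. (p i - s)\<^sup>2)" using k by simp
        then have "L \<le> of_nat k * (2 * s * x - s\<^sup>2) + y\<^sup>2 - w\<^sup>2" using L' cu by simp
        also have "\<dots> = R" using False
          by (simp add: R trunc_sq_def w_def power2_eq_square algebra_simps)
        finally show ?thesis .
      qed
    next
      case 3
      define z where "z = 1 - B"
      have z: "y < z" "z < s" using 3 xy by (auto simp: z_def)
      have za: "z = 1 - A - of_nat (k - r) * s" by (simp add: z_def B_def)
      \<comment> \<open>Outside \<open>T\<close> the entries are at most \<open>s\<close> and their
        mass is \<open>(k - r) * s + z\<close>, so packing has \<open>k - r\<close> full entries and
        the rest \<open>z\<close>.\<close>
      have "Out \<le> of_nat (k - r) * s\<^sup>2 + (sum p (I - T) - of_nat (k - r) * s)\<^sup>2"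
        unfolding Out_def
        by (rule sum_squares_packing)
          (use I out z xy in \<open>auto simp: out_sum za algebra_simps\<close>)
      then have "Out \<le> (of_nat k - of_nat r) * s\<^sup>2 + z\<^sup>2"
        by (simp add: out_sum za kr)
      moreover have A: "A = 1 - z - (of_nat k - of_nat r) * s" by (simp add: za kr)
      have "2 * s * A = 2 * s * (1 - z) - 2 * ((of_nat k - of_nat r) * s\<^sup>2)"
        unfolding A by (simp add: power2_eq_square algebra_simps)
      ultimately have "L \<le> z\<^sup>2 + 2 * s * (1 - z) - of_nat k * s\<^sup>2"
        unfolding L by (simp add: left_diff_distrib)
      \<comment> \<open>\<open>t^2 - 2 * s * t\<close> decreases for \<open>t \<le> s\<close>, so
        \<open>z\<close> may be lowered to \<open>y\<close>; the product is the difference of the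
        two values.\<close>
      moreover have "0 \<le> (z - y) * (2 * s - z - y)"
        using z xy by (intro mult_nonneg_nonneg) auto
      then have "z\<^sup>2 - 2 * s * z \<le> y\<^sup>2 - 2 * s * y"
        by (simp add: power2_eq_square algebra_simps)
      ultimately show ?thesis
        using z unfolding R Reasy by (simp add: trunc_sq_def algebra_simps)
    qed
  qed
  then show ?thesis by (simp add: L_def R_def)
qed

subsection \<open>Entropy of probability vectors\<close>

lemma xlogx_divide:
  assumes "0 \<le> u" "0 < v"
  shows "xlogx (u / v) = xlogx u / v - u / v * ln v"
  using assms by (auto simp: xlogx_def ln_div diff_divide_distrib algebra_simps)

definition entropy_of :: "real \<Rightarrow> 'i set \<Rightarrow> ('i \<Rightarrow> real) \<Rightarrow> real" where
  "entropy_of \<alpha> I p = (if \<alpha> = 1 then - (\<Sum>i\<in>I. xlogx (p i))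
     else ln (\<Sum>i\<in>I. p i powr \<alpha>) / (1 - \<alpha>))"

text \<open>The formula for \<open>g_fun\<close> is the entropy of an explicit vector
  \<open>q\<close> whose sum of squares is exactly \<open>c\<close>, while for \<open>p\<close> the
  number \<open>c\<close> is just an upper bound. Comparing the sums of truncated squares of
  \<open>p\<close> and \<open>q\<close> covers this gap as well.\<close>

lemma g_fun_le_entropy_of:
  fixes p :: "'i \<Rightarrow> real"
  assumes \<alpha>: "1 \<le> \<alpha>" "\<alpha> < 2"
    and I: "finite I" and p: "\<And>i. i \<in> I \<Longrightarrow> 0 \<le> p i" and p1: "sum p I = 1"
    and pc: "(\<Sum>i\<in>I. (p i)\<^sup>2) \<le> c" and c1: "c \<le> 1"
  shows "g_fun \<alpha> c \<le> entropy_of \<alpha> I p"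
proof -
  obtain i0 where i0: "i0 \<in> I" "p i0 \<noteq> 0"
    using p1 by (metis sum.neutral zero_neq_one)
  have "0 < (\<Sum>i\<in>I. (p i)\<^sup>2)"
    using i0 I by (intro sum_pos2[of I i0]) auto
  with pc have c: "0 < c" by simp
  have p_le: "p i \<le> 1" if "i \<in> I" for i
    using member_le_sum[of i I p] that I p p1 by simp
  define k where "k = nat \<lfloor>1 / c\<rfloor>"
  have "1 \<le> 1 / c" using c c1 by simp
  then have k0: "0 < k" unfolding k_def by simp
  have rk: "real k = of_int \<lfloor>1 / c\<rfloor>" unfolding k_def using c by simp
  have "real k \<le> 1 / c" "1 / c < real k + 1" unfolding rk by linarith+
  \<comment> \<open>\<open>1 \<le> (k + 1) * c\<close> makes the radicand of \<open>D\<close>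
    nonnegative, and \<open>k * c \<le> 1\<close> gives \<open>k * D \<le> 1\<close>, hence
    \<open>0 \<le> y\<close>.\<close>
  then have kc: "real k * c \<le> 1" "1 \<le> (real k + 1) * c"
    using c by (auto simp: field_simps)
  define D where "D = sqrt (c - (1 - c) / real k)"
  have D2: "real k * D\<^sup>2 = (real k + 1) * c - 1"
  proof -
    have "0 \<le> c - (1 - c) / real k" using kc k0 by (simp add: field_simps)
    then have "D\<^sup>2 = c - (1 - c) / real k" by (simp add: D_def)
    then show ?thesis using k0 by (simp add: field_simps)
  qed
  have D0: "0 \<le> D"
    using kc k0 by (auto simp: D_def field_simps)
  have "(real k * D)\<^sup>2 = real k * (real k * D\<^sup>2)" by (simp add: power2_eq_square)
  also have "\<dots> = (real k + 1) * (real k * c) - real k" unfolding D2 by (simp add: algebra_simps)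
  also have "\<dots> \<le> (real k + 1) * 1 - real k"
    by (intro diff_right_mono mult_left_mono kc) simp
  also have "\<dots> = 1\<^sup>2" by simp
  finally have kD: "real k * D \<le> 1" by (rule power2_le_imp_le) simp
  \<comment> \<open>The solution with \<open>y \<le> x\<close> of \<open>k * x + y = 1\<close> and
    \<open>k * x^2 + y^2 = c\<close>.\<close>
  define x y where "x = (1 + D) / (1 + real k)" and "y = (1 - real k * D) / (1 + real k)"
  have k1: "0 < 1 + real k" by simp
  have "0 \<le> real k * D" using D0 by simp
  then have "1 - real k * D \<le> 1 + D" using D0 by linarith
  then have xy: "0 \<le> y" "y \<le> x"
    using kD D0 k1 unfolding x_def y_def by (auto intro!: divide_right_mono)
  have xy1: "real k * x + y = 1"
    using k1 unfolding x_def y_def by (simp add: field_simps)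
  have xyc: "real k * x\<^sup>2 + y\<^sup>2 = c"
  proof -
    have "(1 + real k)\<^sup>2 * (real k * x\<^sup>2 + y\<^sup>2) = real k * (1 + D)\<^sup>2 + (1 - real k * D)\<^sup>2"
      using k1 unfolding x_def y_def by (simp add: power_divide field_simps)
    also have "\<dots> = (1 + real k) * (1 + real k * D\<^sup>2)"
      by (simp add: power2_eq_square algebra_simps)
    also have "\<dots> = (1 + real k)\<^sup>2 * c"
      unfolding D2 by (simp add: power2_eq_square algebra_simps)
    finally show ?thesis using k1 by simp
  qed
  have x1: "x \<le> 1"
  proof -
    have "1 * x \<le> real k * x" using k0 xy by (intro mult_right_mono) auto
    then show ?thesis using xy1 xy by simp
  qed
  \<comment> \<open>The vector lives on \<open>{..k}\<close>, which has \<open>k + 1\<close>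
    indices; index \<open>k\<close> carries \<open>y\<close>.\<close>
  define q where "q i = (if i < k then x else y)" for i
  have qsum: "(\<Sum>i\<in>{..k}. f (q i)) = real k * f x + f y" for f :: "real \<Rightarrow> real"
  proof -
    have "(\<Sum>i\<in>{..k}. f (q i)) = (\<Sum>i<k. f (q i)) + f (q k)"
      by (simp add: lessThan_Suc_atMost[symmetric])
    also have "(\<Sum>i<k. f (q i)) = (\<Sum>i<k. f x)" by (rule sum.cong) (auto simp: q_def)
    finally show ?thesis by (simp add: q_def)
  qed
  have q: "0 \<le> q i" "q i \<le> 1" for i using xy x1 by (auto simp: q_def)
  have eq: "sum p I = sum q {..k}" using qsum[of "\<lambda>z. z"] p1 xy1 by simp
  have le: "(\<Sum>i\<in>I. trunc_sq s (p i)) \<le> (\<Sum>j\<in>{..k}. trunc_sq s (q j))" if "0 < s" "s \<le> 1" for s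
    unfolding qsum by (rule sum_trunc_sq_le[OF I p p1 pc k0 xy xy1 xyc that(1)])
  show ?thesis
  proof (cases "\<alpha> = 1")
    case True
    have "(\<Sum>i\<in>I. xlogx (p i)) \<le> real k * xlogx x + xlogx y"
      unfolding qsum[symmetric]
      by (rule sum_xlogx_le_if_trunc_sq_sum_le[OF I _ p p_le q eq le]) auto
    moreover have "g_fun \<alpha> c = - (real k * xlogx x + xlogx y)"
    proof -
      \<comment> \<open>The common denominator contributes \<open>ln (1 + k)\<close> with total
        weight \<open>k * x + y = 1\<close>.\<close>
      have "real k * xlogx x + xlogx y
          = (real k * xlogx (1 + D) + xlogx (1 - real k * D)) / (1 + real k)
            - (real k * x + y) * ln (1 + real k)"
        using D0 kD k1 unfolding x_def y_def
        by (subst (1 2) xlogx_divide) (auto simp: algebra_simps add_divide_distrib)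
      then show ?thesis
        unfolding xy1 using True by (simp add: g_fun_def Let_def add.commute flip: k_def D_def)
    qed
    ultimately show ?thesis using True by (simp add: entropy_of_def)
  next
    case False
    then have \<alpha>1: "1 < \<alpha>" using \<alpha> by simp
    have "(\<Sum>i\<in>I. p i powr \<alpha>) \<le> real k * x powr \<alpha> + y powr \<alpha>"
      unfolding qsum[of "\<lambda>z. z powr \<alpha>", symmetric]
      by (rule sum_powr_le_if_trunc_sq_sum_le[OF \<alpha>1 \<alpha>(2) I _ p p_le q eq le]) auto
    moreover have "0 < (\<Sum>i\<in>I. p i powr \<alpha>)"
      using i0 I p[OF i0(1)] by (intro sum_pos2[of I i0]) auto
    ultimately have "ln (\<Sum>i\<in>I. p i powr \<alpha>) \<le> ln (real k * x powr \<alpha> + y powr \<alpha>)" by simp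
    then have "ln (real k * x powr \<alpha> + y powr \<alpha>) / (1 - \<alpha>) \<le> ln (\<Sum>i\<in>I. p i powr \<alpha>) / (1 - \<alpha>)"
      using \<alpha>1 by (intro divide_right_mono_neg) auto
    moreover have "g_fun \<alpha> c = ln (real k * x powr \<alpha> + y powr \<alpha>) / (1 - \<alpha>)"
      using False by (simp add: g_fun_def Let_def x_def y_def flip: k_def D_def)
    ultimately show ?thesis using False by (simp add: entropy_of_def)
  qed
qed

section \<open>Entropy of two-point distributions\<close>

text \<open>\<open>(1 + d) / 2\<close> and \<open>(1 - d) / 2\<close> are the two probabilities
  whose squares sum to \<open>c\<close>. In \<open>g_fun\<close> the number \<open>k\<close> jumps
  at \<open>c = 1 / 2\<close>; this single expression on \<open>{1 / 2..1}\<close> is the form in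
  which continuity can be read off.\<close>

definition qubit_entropy :: "real \<Rightarrow> real \<Rightarrow> real" where
  "qubit_entropy \<alpha> c = (let d = sqrt (2 * c - 1) in
     if \<alpha> = 1 then - (xlogx ((1 + d) / 2) + xlogx ((1 - d) / 2))
     else ln (((1 + d) / 2) powr \<alpha> + ((1 - d) / 2) powr \<alpha>) / (1 - \<alpha>))"

lemma g_fun_eq_qubit_entropy:
  assumes "1 \<le> \<alpha>" "1 / 2 \<le> c" "c \<le> 1"
  shows "g_fun \<alpha> c = qubit_entropy \<alpha> c"
proof (cases "c = 1 / 2")
  case True
  \<comment> \<open>At this endpoint \<open>k\<close> is 2, but then \<open>x = 1 / 2\<close> and
    \<open>y = 0\<close>, so only a zero entry is added to the pair of equal probabilities.\<close>
  show ?thesis unfolding True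
    by (simp add: g_fun_def qubit_entropy_def Let_def xlogx_def real_sqrt_divide ln_div field_simps)
next
  case False
  then have "\<lfloor>1 / c\<rfloor> = 1" using assms by (intro floor_unique) (auto simp: field_simps)
  then have k: "nat \<lfloor>1 / c\<rfloor> = 1" by simp
  have d: "0 \<le> sqrt (2 * c - 1)" "sqrt (2 * c - 1) \<le> 1" using assms by auto
  have c: "c - (1 - c) = 2 * c - 1" by simp
  show ?thesis unfolding g_fun_def qubit_entropy_def k Let_def
    using d by (simp add: c xlogx_divide) (simp add: field_simps)
qed

lemma entropy_of_two_eq_qubit_entropy:
  fixes p :: "nat \<Rightarrow> real"
  assumes "p 0 + p 1 = 1"
  shows "entropy_of \<alpha> {..<2} p = qubit_entropy \<alpha> ((p 0)\<^sup>2 + (p 1)\<^sup>2)"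
proof -
  have p1: "p 1 = 1 - p 0" using assms by simp
  have "2 * ((p 0)\<^sup>2 + (p 1)\<^sup>2) - 1 = (2 * p 0 - 1)\<^sup>2"
    unfolding p1 by (simp add: power2_eq_square algebra_simps)
  then have d: "sqrt (2 * ((p 0)\<^sup>2 + (p 1)\<^sup>2) - 1) = \<bar>2 * p 0 - 1\<bar>" by simp
  have "{..<2} = {0, 1::nat}" by auto
  then have s: "(\<Sum>i<2. f (p i)) = f (p 0) + f (1 - p 0)" for f :: "real \<Rightarrow> real"
    using p1 by simp
  show ?thesis
    unfolding qubit_entropy_def entropy_of_def d s[of xlogx] s[of "\<lambda>z. z powr \<alpha>"] Let_def
    \<comment> \<open>The sign tells which of \<open>p 0\<close> and \<open>p 1\<close> is the
      larger probability.\<close>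
    by (cases "0 \<le> 2 * p 0 - 1") (auto simp: algebra_simps diff_divide_distrib add_divide_distrib)
qed

lemma continuous_on_xlogx: "continuous_on {0..} xlogx"
proof -
  have "continuous (at x within {0..}) xlogx" if "0 \<le> x" for x
  proof (cases "x = 0")
    case True
    have "((\<lambda>x. x * ln x) \<longlongrightarrow> 0) (at_right (0::real))" by real_asymp
    then have "(xlogx \<longlongrightarrow> 0) (at_right 0)"
      by (rule Lim_transform_eventually)
        (auto simp: xlogx_def eventually_at_right_field intro!: exI[of _ 1])
    moreover have "at (0::real) within {0..} = at_right 0"
      by (simp add: at_within_Ici_at_right)
    ultimately show ?thesis using True by (simp add: continuous_within xlogx_def)
  next
    case False
    then have "0 < x" using that by simp
    have "isCont (\<lambda>x. x * ln x) x" using False by (intro continuous_intros) auto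
    moreover have "\<forall>\<^sub>F z in nhds x. z * ln z = xlogx z"
      using eventually_nhds_in_open[of "{0<..}" x] \<open>0 < x\<close>
      by (auto elim!: eventually_mono simp: xlogx_def)
    ultimately have "isCont xlogx x" using isCont_cong by metis
    then show ?thesis by (rule continuous_at_imp_continuous_at_within)
  qed
  then show ?thesis by (simp add: continuous_on_eq_continuous_within)
qed

lemma continuous_on_qubit_entropy:
  assumes "1 \<le> \<alpha>"
  shows "continuous_on {1 / 2..1} (qubit_entropy \<alpha>)"
proof -
  have d: "0 \<le> sqrt (2 * c - 1)" "sqrt (2 * c - 1) \<le> 1" if "c \<in> {1 / 2..1}" for c :: real
    using that by auto
  show ?thesis
  proof (cases "\<alpha> = 1")
    case True
    then show ?thesis unfolding qubit_entropy_def Let_def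
      using d by (auto intro!: continuous_intros continuous_on_compose2[OF continuous_on_xlogx])
  next
    case False
    have "((1 + sqrt (2 * c - 1)) / 2) powr \<alpha> + ((1 - sqrt (2 * c - 1)) / 2) powr \<alpha> \<noteq> 0"
      if "c \<in> {1 / 2..1}" for c
    proof -
      have "0 < 1 + sqrt (2 * c - 1)" using d(1)[OF that] by linarith
      then show ?thesis by (intro add_pos_nonneg[THEN less_imp_neq, symmetric]) auto
    qed
    then show ?thesis unfolding qubit_entropy_def Let_def
      using d False assms by (auto intro!: continuous_intros continuous_on_powr')
  qed
qed

subsection \<open>Spectral decomposition of Hermitian matrices\<close>

lemma mat_adjoint_dims [simp]:
  "dim_row (mat_adjoint A) = dim_col A" "dim_col (mat_adjoint A) = dim_row A"
  by (simp_all add: mat_adjoint_def)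

lemma mat_adjoint_carrier [simp]: "A \<in> carrier_mat m n \<Longrightarrow> mat_adjoint A \<in> carrier_mat n m"
  by (intro carrier_matI) auto

lemma index_mat_adjoint [simp]:
  "i < dim_col A \<Longrightarrow> j < dim_row A \<Longrightarrow> mat_adjoint A $$ (i, j) = conjugate (A $$ (j, i))"
  by (simp add: mat_adjoint_def mat_of_rows_def)

lemma mat_adjoint_adjoint [simp]: "mat_adjoint (mat_adjoint A) = A"
  by (rule eq_matI) auto

lemma mat_adjoint_mult:
  fixes A B :: "complex mat"
  assumes "A \<in> carrier_mat m n" "B \<in> carrier_mat n l"
  shows "mat_adjoint (A * B) = mat_adjoint B * mat_adjoint A"
proof (rule eq_matI)
  fix i j
  assume "i < dim_row (mat_adjoint B * mat_adjoint A)" "j < dim_col (mat_adjoint B * mat_adjoint A)"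
  then have "i < l" "j < m" using assms by auto
  then show "mat_adjoint (A * B) $$ (i, j) = (mat_adjoint B * mat_adjoint A) $$ (i, j)"
    using assms by (simp add: scalar_prod_def sum_conjugate conjugate_dist_mul mult.commute)
qed (use assms in auto)

lemma hermitian_mat_iff_adjoint:
  "hermitian_mat n A \<longleftrightarrow> A \<in> carrier_mat n n \<and> mat_adjoint A = A"
proof
  assume her: "hermitian_mat n A"
  note A = her[unfolded hermitian_mat_def, THEN conjunct1]
  note sym = her[unfolded hermitian_mat_def, THEN conjunct2, rule_format, symmetric]
  have "mat_adjoint A = A"
    using A by (intro eq_matI) (simp_all add: sym)
  with A show "A \<in> carrier_mat n n \<and> mat_adjoint A = A" ..
next
  assume A: "A \<in> carrier_mat n n \<and> mat_adjoint A = A"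
  have "mat_adjoint A $$ (i, j) = cnj (A $$ (j, i))" if "i < n" "j < n" for i j
    using that A by (subst index_mat_adjoint) auto
  then have "\<forall>i<n. \<forall>j<n. A $$ (i, j) = cnj (A $$ (j, i))"
    unfolding conjunct2[OF A] by blast
  with A show "hermitian_mat n A" unfolding hermitian_mat_def by blast
qed

lemma mat_mult4_assoc:
  assumes "A \<in> carrier_mat n n" "B \<in> carrier_mat n n" "C \<in> carrier_mat n n" "D \<in> carrier_mat n n"
    "E \<in> carrier_mat n n"
  shows "A * (B * C * D) * E = A * B * C * (D * E)"
  using assms by (simp add: assoc_mult_mat[where ?n\<^sub>1=n and ?n\<^sub>2=n and ?n\<^sub>3=n and ?n\<^sub>4=n])

lemma normalized_vec_conjugate_square:
  fixes v :: "complex vec"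
  assumes v: "v \<in> carrier_vec n" and v0: "v \<noteq> 0\<^sub>v n"
  defines "c \<equiv> complex_of_real (1 / sqrt (\<Sum>i<n. (cmod (v $ i))\<^sup>2))"
  shows "c \<noteq> 0" "conjugate c = c" "(c \<cdot>\<^sub>v v) \<bullet>c (c \<cdot>\<^sub>v v) = 1"
proof -
  define N where "N = (\<Sum>i<n. (cmod (v $ i))\<^sup>2)"
  obtain i where "i < n" "v $ i \<noteq> 0" using v v0 by (metis eq_vecI carrier_vecD index_zero_vec)
  then have N: "0 < N" unfolding N_def by (intro sum_pos2[of _ i]) auto
  have c: "c = complex_of_real (1 / sqrt N)" by (simp add: c_def N_def)
  show "c \<noteq> 0" using N by (simp add: c)
  show cc: "conjugate c = c" by (simp add: c)
  have vv: "v \<bullet>c v = complex_of_real N"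
    using v by (simp add: scalar_prod_def N_def atLeast0LessThan complex_norm_square del: of_real_power)
  have "(c \<cdot>\<^sub>v v) \<bullet>c (c \<cdot>\<^sub>v v) = c * c * (v \<bullet>c v)"
    using v cc by (simp add: conjugate_smult_vec)
  also have "\<dots> = complex_of_real (1 / sqrt N * (1 / sqrt N) * N)"
    by (simp only: c vv of_real_mult)
  also have "1 / sqrt N * (1 / sqrt N) * N = 1" using N by simp
  finally show "(c \<cdot>\<^sub>v v) \<bullet>c (c \<cdot>\<^sub>v v) = 1" by simp
qed

text \<open>\<open>corthogonal_inv\<close> divides each conjugated column by its squared length,
  which is 1 here.\<close>

lemma corthogonal_inv_eq_adjoint:
  assumes W: "W = mat_of_cols n ws" and ws: "set ws \<subseteq> carrier_vec n" "length ws = n"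
    and unit: "\<And>w. w \<in> set ws \<Longrightarrow> w \<bullet>c w = 1"
  shows "corthogonal_inv W = mat_adjoint (W :: complex mat)"
proof -
  have "cols W = ws" unfolding W using ws by (simp add: cols_mat_of_cols)
  moreover have "map vec_inv ws = map conjugate ws"
    using unit by (auto simp: vec_inv_def)
  ultimately show ?thesis unfolding corthogonal_inv_def mat_adjoint_def by (simp only:)
qed

text \<open>Complete the eigenvector to a basis and orthogonalise, which keeps the first vector. As
  \<open>gram_schmidt\<close> does not normalise, every vector is then scaled to length 1 to make
  \<open>W\<close> unitary; the first column remains an eigenvector.\<close>

lemma unitary_completion_of_eigenvector:
  fixes A :: "complex mat"
  assumes A: "A \<in> carrier_mat n n" and e: "eigenvalue A e" and n: "n \<noteq> 0"
  obtains W where "W \<in> carrier_mat n n" "mat_adjoint W * W = 1\<^sub>m n" "W * mat_adjoint W = 1\<^sub>m n"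
    "col (mat_adjoint W * A * W) 0 = vec n (\<lambda>i. if i = 0 then e else 0)"
proof -
  define v where "v = find_eigenvector A e"
  define b where "b = basis_completion v"
  define us where "us = gram_schmidt n b"
  have v: "v \<in> carrier_vec n" and v0: "v \<noteq> 0\<^sub>v n" and ev: "A *\<^sub>v v = e \<cdot>\<^sub>v v"
    using find_eigenvector[OF A e, folded v_def, unfolded eigenvector_def] A by simp_all
  interpret cof_vec_space n "TYPE(complex)" .
  from basis_completion[OF v v0, folded b_def]
  have dist_b: "distinct b" and indep: "\<not> lin_dep (set b)" and b: "set b \<subseteq> carrier_vec n"
    and hdb: "hd b = v" and len_b: "length b = n" by auto
  from hdb len_b n obtain vs where bv: "b = v # vs" by (cases b, auto)
  from gram_schmidt_result[OF b dist_b indep refl, folded us_def]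
  have us: "set us \<subseteq> carrier_vec n" "corthogonal us" "length us = n" by (auto simp: len_b)
  have hdus: "hd us = v" using gram_schmidt_hd[OF v, of vs] by (simp add: us_def bv)
  define c where "c u = complex_of_real (1 / sqrt (\<Sum>i<n. (cmod (u $ i))\<^sup>2))" for u :: "complex vec"
  define f where "f u = c u \<cdot>\<^sub>v u" for u
  define ws where "ws = map f us"
  have us0: "u \<noteq> 0\<^sub>v n" if u: "u \<in> set us" for u
  proof -
    obtain i where "i < length us" "u = us ! i" using u by (metis in_set_conv_nth)
    then have "u \<bullet>c u \<noteq> 0" using corthogonalD[OF us(2), of i i] by simp
    then show ?thesis by auto
  qed
  have c: "c u \<noteq> 0" "conjugate (c u) = c u" "f u \<bullet>c f u = 1" if "u \<in> set us" for u
    using normalized_vec_conjugate_square[of u n] us0[OF that] us(1) that by (auto simp: c_def f_def)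
  have ws: "set ws \<subseteq> carrier_vec n" "length ws = n"
    using us by (auto simp: ws_def f_def)
  have orth: "corthogonal ws"
  proof
    fix i j assume ij: "i < length ws" "j < length ws"
    then have mem: "us ! i \<in> set us" "us ! j \<in> set us" using us(3) ws(2) by auto
    have "ws ! i \<bullet>c ws ! j = c (us ! i) * c (us ! j) * (us ! i \<bullet>c us ! j)"
    proof -
      have carr: "us ! i \<in> carrier_vec n" "us ! j \<in> carrier_vec n" using mem us(1) by auto
      then show ?thesis
        using ij c(2)[OF mem(2)]
        by (simp add: ws_def f_def conjugate_smult_vec smult_scalar_prod_distrib[of _ n])
    qed
    then show "(ws ! i \<bullet>c ws ! j = 0) = (i \<noteq> j)"
      using c(1)[OF mem(1)] c(1)[OF mem(2)] corthogonalD[OF us(2), of i j] ij ws us by simp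
  qed
  have v_us: "v \<in> set us" using hdus us(3) n by (metis hd_in_set length_0_conv)
  have hdws: "hd ws = f v" using hdus us(3) n by (auto simp: ws_def hd_map)
  have fv: "f v \<in> carrier_vec n" using v by (simp add: f_def)
  have fv0: "f v \<noteq> 0\<^sub>v n" using c(3)[OF v_us] by auto
  have fev: "A *\<^sub>v f v = e \<cdot>\<^sub>v f v"
    using A v ev by (simp add: f_def mult_mat_vec smult_smult_assoc mult.commute)
  define W where "W = mat_of_cols n ws"
  have W: "W \<in> carrier_mat n n" using ws by (simp add: W_def carrier_matI)
  have inv: "corthogonal_inv W = mat_adjoint W"
    by (rule corthogonal_inv_eq_adjoint[OF W_def ws]) (use c in \<open>auto simp: ws_def\<close>)
  have "corthogonal_mat W" using orthogonal_mat_of_cols[OF ws(1) orth ws(2)] by (simp add: W_def)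
  from corthogonal_inv_result[OF this] have 1: "mat_adjoint W * W = 1\<^sub>m n"
    using W by (simp add: inv inverts_mat_def)
  then have 2: "W * mat_adjoint W = 1\<^sub>m n"
    using W mat_mult_left_right_inverse by (metis mat_adjoint_carrier)
  have "col (mat_adjoint W * A * W) 0 = vec n (\<lambda>i. if i = 0 then e else 0)"
    using corthogonal_col_ev_0[OF A fv fv0 fev n hdws ws(1) orth ws(2)] inv by (simp add: W_def)
  then show ?thesis using that[OF W 1 2] by simp
qed

text \<open>Deflation along the list: a unitary conjugation splits off one eigenvector and the
  induction hypothesis treats the remaining block. The order of the list is arbitrary, so the result
  fits the list chosen by \<open>eigvals\<close>.\<close>

theorem hermitian_spectral_decomposition:
  assumes "hermitian_mat n A" and "char_poly A = (\<Prod>e\<leftarrow>es. [:- e, 1:])"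
  shows "\<exists>U \<in> carrier_mat n n. mat_adjoint U * U = 1\<^sub>m n
    \<and> A = U * mat_diag n (\<lambda>i. es ! i) * mat_adjoint U"
  using assms
proof (induction es arbitrary: n A)
  case Nil
  then have "A \<in> carrier_mat n n" by (simp only: hermitian_mat_iff_adjoint)
  with Nil have "n = 0" "A \<in> carrier_mat n n" using degree_monic_char_poly[of A n] by auto
  then show ?case by (intro bexI[of _ "1\<^sub>m 0"]) (auto intro!: eq_matI)
next
  case (Cons e es)
  from Cons.prems have A: "A \<in> carrier_mat n n" and adj: "mat_adjoint A = A"
    by (auto simp: hermitian_mat_iff_adjoint)
  have cp: "char_poly A = [:- e, 1:] * (\<Prod>e\<leftarrow>es. [:- e, 1:])" using Cons.prems by simp
  have "eigenvalue A e" unfolding eigenvalue_root_char_poly[OF A] cp by simp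
  have "n \<noteq> 0"
  proof
    assume "n = 0"
    then have "degree (char_poly A) = 0" using degree_monic_char_poly[OF A] by simp
    moreover have "monic (\<Prod>e\<leftarrow>es. [:- e, 1:])" by (rule monic_prod_list) auto
    then have "degree (char_poly A) = Suc (degree (\<Prod>e\<leftarrow>es. [:- e, 1:]))"
      unfolding cp by (subst degree_mult_eq) auto
    ultimately show False by simp
  qed
  then obtain m where n: "n = Suc m" by (cases n) auto
  from unitary_completion_of_eigenvector[OF A \<open>eigenvalue A e\<close> \<open>n \<noteq> 0\<close>]
  obtain W where W: "W \<in> carrier_mat n n" and W1: "mat_adjoint W * W = 1\<^sub>m n"
    and W2: "W * mat_adjoint W = 1\<^sub>m n"
    and col: "col (mat_adjoint W * A * W) 0 = vec n (\<lambda>i. if i = 0 then e else 0)" .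
  define A' where "A' = mat_adjoint W * A * W"
  have Wa: "mat_adjoint W \<in> carrier_mat n n" using W by simp
  have A': "A' \<in> carrier_mat n n" using W Wa A unfolding A'_def by (metis mult_carrier_mat)
  have "mat_adjoint A' = mat_adjoint W * (A * W)"
    by (simp add: A'_def mat_adjoint_mult[OF mult_carrier_mat[OF Wa A] W] mat_adjoint_mult[OF Wa A] adj)
  also have "\<dots> = A'" using A W Wa by (simp add: A'_def assoc_mult_mat[of _ n n _ n _ n])
  finally have adj': "mat_adjoint A' = A'" .
  have A'0: "A' $$ (i, 0) = (if i = 0 then e else 0)" if "i < n" for i
  proof -
    have "A' $$ (i, 0) = col A' 0 $ i" using that A' n by simp
    then show ?thesis using that n by (simp only: A'_def col) simp
  qed
  \<comment> \<open>Self-adjointness carries the zeros of the first column over to the first row, so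
    \<open>A'\<close> is block diagonal.\<close>
  have A'0': "A' $$ (0, i) = 0" if "i < n" "i \<noteq> 0" for i
    using that A' n A'0[of i] index_mat_adjoint[of 0 A' i] by (simp add: adj')
  define B where "B = mat m m (\<lambda>(i, j). A' $$ (Suc i, Suc j))"
  have B: "B \<in> carrier_mat m m" by (simp add: B_def)
  define E where "E = mat 1 1 (\<lambda>_. e)"
  have E: "E \<in> carrier_mat 1 1" by (simp add: E_def)
  have blk: "A' = four_block_mat E (0\<^sub>m 1 m) (0\<^sub>m m 1) B"
    using A' n by (intro eq_matI) (auto simp: E_def B_def A'0 A'0')
  have herB: "hermitian_mat m B"
    unfolding hermitian_mat_def
  proof (intro conjI allI impI B)
    fix i j assume "i < m" "j < m"
    then show "B $$ (i, j) = cnj (B $$ (j, i))"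
      using index_mat_adjoint[of "Suc i" A' "Suc j"] A' n by (simp add: B_def adj')
  qed
  \<comment> \<open>Similarity preserves the characteristic polynomial; cancelling the factor of the
    block \<open>E\<close> leaves the product over \<open>es\<close> for \<open>B\<close>.\<close>
  have "similar_mat_wit A' A (mat_adjoint W) W"
    by (rule similar_mat_witI[of _ _ n]) (use W Wa W1 W2 A A' in \<open>auto simp: A'_def\<close>)
  then have "similar_mat A' A" unfolding similar_mat_def by blast
  then have "char_poly A' = [:- e, 1:] * (\<Prod>e\<leftarrow>es. [:- e, 1:])"
    using char_poly_similar cp by metis
  moreover have "char_poly A' = char_poly E * char_poly B"
    unfolding blk by (rule char_poly_four_block_zeros_col[OF E _ B]) simp
  moreover have "char_poly E = [:- e, 1:]"
    by (simp add: E_def char_poly_defs det_def sign_def)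
  ultimately have "char_poly B = (\<Prod>e\<leftarrow>es. [:- e, 1:])"
    by (metis mult_cancel_left pCons_eq_0_iff zero_neq_one)
  from Cons.IH[OF herB this] obtain V where V: "V \<in> carrier_mat m m"
    and V1: "mat_adjoint V * V = 1\<^sub>m m"
    and BV: "B = V * mat_diag m (\<lambda>i. es ! i) * mat_adjoint V" by blast
  define P where "P = four_block_mat (1\<^sub>m 1) (0\<^sub>m 1 m) (0\<^sub>m m 1) V"
  define D where "D = mat_diag n (\<lambda>i. (e # es) ! i)"
  have P: "P \<in> carrier_mat n n" using V n unfolding P_def by (metis four_block_carrier_mat one_carrier_mat plus_1_eq_Suc)
  have D: "D \<in> carrier_mat n n" by (simp add: D_def mat_diag_def)
  have Pa: "mat_adjoint P = four_block_mat (1\<^sub>m 1) (0\<^sub>m 1 m) (0\<^sub>m m 1) (mat_adjoint V)"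
    using V n unfolding P_def by (intro eq_matI) auto
  have Dblk: "D = four_block_mat E (0\<^sub>m 1 m) (0\<^sub>m m 1) (mat_diag m (\<lambda>i. es ! i))"
    using n by (intro eq_matI) (auto simp: D_def E_def mat_diag_def nth_Cons')
  have Va: "mat_adjoint V \<in> carrier_mat m m" using V by simp
  have dm: "mat_diag m (\<lambda>i. es ! i) \<in> carrier_mat m m" by (simp add: mat_diag_def)
  note mult = mult_four_block_mat[where ?nr1.0=1 and ?n1.0=1 and ?n2.0=m and ?nr2.0=m and ?nc1.0=1 and ?nc2.0=m]
  have PP: "mat_adjoint P * P = 1\<^sub>m n"
    unfolding Pa unfolding P_def using V Va n V1
    by (subst mult) auto
  have "P * D = four_block_mat E (0\<^sub>m 1 m) (0\<^sub>m m 1) (V * mat_diag m (\<lambda>i. es ! i))"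
    unfolding P_def Dblk using V E dm
    by (subst mult) (auto simp: left_mult_zero_mat[OF dm])
  then have PDP: "P * D * mat_adjoint P = A'"
    unfolding Pa blk BV
    using V Va E dm mult_carrier_mat[OF V dm] mult_carrier_mat[OF mult_carrier_mat[OF V dm] Va]
    by (simp add: mult right_mult_zero_mat[OF mult_carrier_mat[OF V dm]]
        left_add_zero_mat[OF mult_carrier_mat[OF mult_carrier_mat[OF V dm] Va]])
  have "A = W * A' * mat_adjoint W"
  proof -
    have "W * A' * mat_adjoint W = (W * mat_adjoint W) * A * (W * mat_adjoint W)"
      unfolding A'_def using mat_mult4_assoc[OF W Wa A W Wa] .
    then show ?thesis using W2 A by simp
  qed
  also have "\<dots> = W * P * D * mat_adjoint (W * P)"
    unfolding PDP[symmetric] mat_adjoint_mult[OF W P]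
    using mat_mult4_assoc[OF W P D _ Wa] P by simp
  finally have "A = W * P * D * mat_adjoint (W * P)" .
  moreover have "mat_adjoint (W * P) * (W * P) = 1\<^sub>m n"
  proof -
    have "mat_adjoint W * (W * P) = P"
      using P by (simp add: assoc_mult_mat[OF Wa W P, symmetric] W1)
    then have "mat_adjoint (W * P) * (W * P) = mat_adjoint P * P"
      using W P Wa by (simp add: mat_adjoint_mult[OF W P]
        assoc_mult_mat[OF mat_adjoint_carrier[OF P] Wa mult_carrier_mat[OF W P]])
    then show ?thesis using PP by simp
  qed
  ultimately show ?case using W P unfolding D_def by (intro bexI[of _ "W * P"]) auto
qed

subsection \<open>Density matrices\<close>

lemma mtrace_mult_comm:
  assumes "A \<in> carrier_mat n m" "B \<in> carrier_mat m n"
  shows "mtrace (A * B) = mtrace (B * A)"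
proof -
  have "mtrace (A * B) = (\<Sum>i<n. \<Sum>j<m. A $$ (i, j) * B $$ (j, i))"
    using assms by (simp add: mtrace_def scalar_prod_def atLeast0LessThan)
  also have "\<dots> = (\<Sum>j<m. \<Sum>i<n. B $$ (j, i) * A $$ (i, j))"
    by (subst sum.swap) (simp add: mult.commute)
  also have "\<dots> = mtrace (B * A)"
    using assms by (simp add: mtrace_def scalar_prod_def atLeast0LessThan)
  finally show ?thesis .
qed

lemma frob_norm_square:
  assumes "A \<in> carrier_mat m n"
  shows "complex_of_real ((frob_norm A)\<^sup>2) = mtrace (A * mat_adjoint A)"
proof -
  have "(frob_norm A)\<^sup>2 = (\<Sum>i<m. \<Sum>j<n. (cmod (A $$ (i, j)))\<^sup>2)"
    using assms by (simp add: frob_norm_def sum_nonneg)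
  then have "complex_of_real ((frob_norm A)\<^sup>2) = (\<Sum>i<m. \<Sum>j<n. A $$ (i, j) * cnj (A $$ (i, j)))"
    by (simp add: complex_norm_square del: of_real_power)
  also have "\<dots> = mtrace (A * mat_adjoint A)"
    using assms by (simp add: mtrace_def scalar_prod_def atLeast0LessThan)
  finally show ?thesis .
qed

text \<open>The choice in \<open>eigvals\<close> succeeds because characteristic polynomials split
  over the complex numbers; later facts about the spectrum start from these two properties.\<close>

lemma eigvals:
  assumes "A \<in> carrier_mat n n"
  shows "length (eigvals A) = n" "char_poly A = (\<Prod>e\<leftarrow>eigvals A. [:- e, 1:])"
proof -
  have "\<exists>es. length es = dim_row A \<and> char_poly A = (\<Prod>e\<leftarrow>es. [:- e, 1:])"
    using char_poly_factorized[OF assms] assms by auto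
  from someI_ex[OF this] show "length (eigvals A) = n" "char_poly A = (\<Prod>e\<leftarrow>eigvals A. [:- e, 1:])"
    using assms by (auto simp: eigvals_def)
qed

lemma hermitian_eigvals:
  assumes "hermitian_mat n A"
  obtains U D where "U \<in> carrier_mat n n" "mat_adjoint U * U = 1\<^sub>m n"
    "D = mat_diag n (\<lambda>i. eigvals A ! i)" "A = U * D * mat_adjoint U" "A * U = U * D"
proof -
  have A: "A \<in> carrier_mat n n" using assms by (simp add: hermitian_mat_iff_adjoint)
  define D where "D = mat_diag n (\<lambda>i. eigvals A ! i)"
  obtain U where U: "U \<in> carrier_mat n n" "mat_adjoint U * U = 1\<^sub>m n"
    and AU: "A = U * D * mat_adjoint U"
    unfolding D_def using hermitian_spectral_decomposition[OF assms eigvals(2)[OF A]] by blast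
  have D: "D \<in> carrier_mat n n" by (simp add: D_def mat_diag_def)
  have "A * U = U * D * (mat_adjoint U * U)"
    by (subst AU) (rule assoc_mult_mat[OF mult_carrier_mat[OF U(1) D] mat_adjoint_carrier[OF U(1)] U(1)])
  also have "\<dots> = U * D" using U D by (simp add: U(2))
  finally show ?thesis using that[OF U D_def AU] by simp
qed

lemma unitary_col_norm:
  assumes "U \<in> carrier_mat n n" "mat_adjoint U * U = 1\<^sub>m n" "k < n"
  shows "(\<Sum>a<n. cnj (U $$ (a, k)) * U $$ (a, k)) = 1"
proof -
  have "(mat_adjoint U * U) $$ (k, k) = (\<Sum>a<n. cnj (U $$ (a, k)) * U $$ (a, k))"
    using assms(1,3) by (simp add: scalar_prod_def atLeast0LessThan)
  then show ?thesis using assms(2,3) by simp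
qed

lemma mat_diag_carrier: "mat_diag n f \<in> carrier_mat n n"
  by (simp add: mat_diag_def)

lemma mtrace_hermitian:
  assumes "hermitian_mat n A"
  shows "mtrace A = (\<Sum>k<n. eigvals A ! k)"
proof -
  obtain U D where U: "U \<in> carrier_mat n n" "mat_adjoint U * U = 1\<^sub>m n"
    and D_def: "D = mat_diag n (\<lambda>i. eigvals A ! i)" and A: "A = U * D * mat_adjoint U"
    by (rule hermitian_eigvals[OF assms])
  have D: "D \<in> carrier_mat n n" by (simp add: D_def mat_diag_carrier)
  have Ua: "mat_adjoint U \<in> carrier_mat n n" using U by simp
  have "mtrace A = mtrace (mat_adjoint U * (U * D))"
    by (subst A) (rule mtrace_mult_comm[OF mult_carrier_mat[OF U(1) D] Ua])
  also have "mat_adjoint U * (U * D) = D"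
    using D by (simp add: assoc_mult_mat[OF Ua U(1) D, symmetric] U(2))
  finally show ?thesis by (simp add: D_def mtrace_def mat_diag_def)
qed

lemma frob_norm_hermitian:
  assumes "hermitian_mat n A"
  shows "complex_of_real ((frob_norm A)\<^sup>2) = (\<Sum>k<n. (eigvals A ! k)\<^sup>2)"
proof -
  obtain U D where U: "U \<in> carrier_mat n n" "mat_adjoint U * U = 1\<^sub>m n"
    and D_def: "D = mat_diag n (\<lambda>i. eigvals A ! i)" and A: "A = U * D * mat_adjoint U"
    and AU: "A * U = U * D"
    by (rule hermitian_eigvals[OF assms])
  have D: "D \<in> carrier_mat n n" by (simp add: D_def mat_diag_carrier)
  have Ua: "mat_adjoint U \<in> carrier_mat n n" using U by simp
  have UD: "U * D \<in> carrier_mat n n" using U D by simp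
  have adj: "mat_adjoint A = A" "A \<in> carrier_mat n n"
    using assms by (auto simp: hermitian_mat_iff_adjoint)
  have AUD: "A * (U * D) = U * (D * D)"
    by (simp add: assoc_mult_mat[OF adj(2) U(1) D, symmetric] AU assoc_mult_mat[OF U(1) D D])
  have "complex_of_real ((frob_norm A)\<^sup>2) = mtrace (A * A)"
    using frob_norm_square[OF adj(2)] adj(1) by simp
  also have "A * A = A * (U * D) * mat_adjoint U"
    by (subst (2) A) (rule assoc_mult_mat[OF adj(2) UD Ua, symmetric])
  also have "mtrace \<dots> = mtrace (mat_adjoint U * (U * (D * D)))"
    unfolding AUD by (rule mtrace_mult_comm[OF mult_carrier_mat[OF U(1) mult_carrier_mat[OF D D]] Ua])
  also have "mat_adjoint U * (U * (D * D)) = D * D"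
    using D by (simp add: assoc_mult_mat[OF Ua U(1) mult_carrier_mat[OF D D], symmetric] U(2))
  finally show ?thesis
    by (simp add: D_def mtrace_def mat_diag_def scalar_prod_def power2_eq_square if_distrib
        if_distribR cong: if_cong)
qed

lemma psd_eigvals:
  assumes "psd_mat n A" "k < n"
  shows "eigvals A ! k \<in> \<real>" "0 \<le> Re (eigvals A ! k)"
proof -
  have her: "hermitian_mat n A" using assms by (simp add: psd_mat_def)
  obtain U D where U: "U \<in> carrier_mat n n" "mat_adjoint U * U = 1\<^sub>m n"
    and D_def: "D = mat_diag n (\<lambda>i. eigvals A ! i)" and AU: "A * U = U * D"
    by (rule hermitian_eigvals[OF her])
  have D: "D \<in> carrier_mat n n" by (simp add: D_def mat_diag_carrier)
  have Ua: "mat_adjoint U \<in> carrier_mat n n" using U by simp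
  have adj: "mat_adjoint A = A" "A \<in> carrier_mat n n"
    using her by (auto simp: hermitian_mat_iff_adjoint)
  have D_eq: "D = mat_adjoint U * (A * U)"
    using D by (simp add: AU assoc_mult_mat[OF Ua U(1) D, symmetric] U(2))
  \<comment> \<open>As a unitary conjugate of \<open>A\<close>, \<open>D\<close> is self-adjoint, so
    its diagonal is real.\<close>
  have "mat_adjoint D = D"
    unfolding D_eq mat_adjoint_mult[OF Ua mult_carrier_mat[OF adj(2) U(1)]] mat_adjoint_mult[OF adj(2) U(1)]
    by (simp add: adj assoc_mult_mat[OF Ua adj(2) U(1)])
  then have "cnj (D $$ (k, k)) = D $$ (k, k)"
    using index_mat_adjoint[of k D k] D assms(2) by simp
  then show real: "eigvals A ! k \<in> \<real>"
    using assms(2) by (simp add: D_def mat_diag_def Reals_cnj_iff)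
  \<comment> \<open>Column \<open>k\<close> of \<open>U\<close> is a unit eigenvector, so the
    quadratic form of \<open>A\<close> there is the eigenvalue itself.\<close>
  define v where "v = col U k"
  have v: "v \<in> carrier_vec n" using U assms(2) by (simp add: v_def)
  have Av: "(A *\<^sub>v v) $ i = eigvals A ! k * v $ i" if "i < n" for i
  proof -
    have "(A *\<^sub>v v) $ i = (A * U) $$ (i, k)"
      using that adj(2) U assms(2) by (simp add: v_def)
    also have "\<dots> = (\<Sum>j<n. U $$ (i, j) * (if j = k then eigvals A ! k else 0))"
      unfolding AU using that U assms(2)
      by (simp add: D_def mat_diag_def scalar_prod_def atLeast0LessThan)
    also have "\<dots> = eigvals A ! k * U $$ (i, k)"
      using assms(2) by (simp add: if_distrib cong: if_cong)
    finally show ?thesis using that U assms(2) by (simp add: v_def)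
  qed
  have "(\<Sum>i<n. cnj (v $ i) * (A *\<^sub>v v) $ i) = eigvals A ! k * (\<Sum>i<n. cnj (v $ i) * v $ i)"
    by (simp add: Av sum_distrib_left mult_ac)
  also have "(\<Sum>i<n. cnj (v $ i) * v $ i) = 1"
    using unitary_col_norm[OF U assms(2)] U assms(2) by (simp add: v_def)
  finally have "(\<Sum>i<n. cnj (v $ i) * (A *\<^sub>v v) $ i) = eigvals A ! k" by simp
  moreover have "0 \<le> Re (\<Sum>i<n. cnj (v $ i) * (A *\<^sub>v v) $ i)"
    using assms(1) v unfolding psd_mat_def by blast
  ultimately show "0 \<le> Re (eigvals A ! k)" by metis
qed

text \<open>The passage from states to probability vectors, through which the bounds for
  \<open>entropy_of\<close> reach matrices: the trace gives the sum and the Frobenius norm the sum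
  of squares.\<close>

lemma density_eigvals:
  assumes "\<sigma> \<in> density_mats n"
  defines "p \<equiv> \<lambda>k. Re (eigvals \<sigma> ! k)"
  shows "\<And>k. k < n \<Longrightarrow> eigvals \<sigma> ! k = complex_of_real (p k)"
    and "\<And>k. k < n \<Longrightarrow> 0 \<le> p k" and "sum p {..<n} = 1"
    and "(\<Sum>k<n. (p k)\<^sup>2) = (frob_norm \<sigma>)\<^sup>2"
    and "trace_norm \<sigma> = 1"
    and "renyi \<alpha> \<sigma> = entropy_of \<alpha> {..<n} p"
proof -
  have psd: "psd_mat n \<sigma>" and tr: "mtrace \<sigma> = 1" using assms by (auto simp: density_mats_def)
  have her: "hermitian_mat n \<sigma>" using psd by (simp add: psd_mat_def)
  then have "\<sigma> \<in> carrier_mat n n" by (simp add: hermitian_mat_iff_adjoint)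
  note len = eigvals(1)[OF this]
  show ev: "\<And>k. k < n \<Longrightarrow> eigvals \<sigma> ! k = complex_of_real (p k)"
    using psd_eigvals(1)[OF psd] by (simp add: p_def)
  show p: "\<And>k. k < n \<Longrightarrow> 0 \<le> p k" using psd_eigvals(2)[OF psd] by (simp add: p_def)
  have "complex_of_real (sum p {..<n}) = complex_of_real 1"
    using mtrace_hermitian[OF her] tr ev by simp
  then show p1: "sum p {..<n} = 1" unfolding of_real_eq_iff .
  have "complex_of_real (\<Sum>k<n. (p k)\<^sup>2) = complex_of_real ((frob_norm \<sigma>)\<^sup>2)"
    unfolding frob_norm_hermitian[OF her] using ev by simp
  then show "(\<Sum>k<n. (p k)\<^sup>2) = (frob_norm \<sigma>)\<^sup>2" unfolding of_real_eq_iff .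
  have "trace_norm \<sigma> = (\<Sum>k<n. cmod (eigvals \<sigma> ! k))"
    by (simp add: trace_norm_def sum_list_sum_nth len atLeast0LessThan)
  also have "\<dots> = sum p {..<n}" by (rule sum.cong) (use ev p in auto)
  finally show "trace_norm \<sigma> = 1" using p1 by simp
  show "renyi \<alpha> \<sigma> = entropy_of \<alpha> {..<n} p"
    by (simp add: renyi_def entropy_of_def sum_list_sum_nth len atLeast0LessThan p_def)
qed

section \<open>Frobenius norm and rank-one states\<close>

lemma frob_norm_eq_L2_set:
  assumes "A \<in> carrier_mat r c"
  shows "frob_norm A = L2_set (\<lambda>(i, j). cmod (A $$ (i, j))) ({..<r} \<times> {..<c})"
  using assms by (simp add: frob_norm_def L2_set_def sum.cartesian_product split_def)

lemma frob_norm_triangle: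
  assumes "A \<in> carrier_mat r c" "B \<in> carrier_mat r c"
  shows "frob_norm (A + B) \<le> frob_norm A + frob_norm B"
proof -
  have AB: "A + B \<in> carrier_mat r c" using assms by simp
  have "frob_norm (A + B) \<le> L2_set (\<lambda>x. (case x of (i, j) \<Rightarrow> cmod (A $$ (i, j)))
      + (case x of (i, j) \<Rightarrow> cmod (B $$ (i, j)))) ({..<r} \<times> {..<c})"
    unfolding frob_norm_eq_L2_set[OF AB] using assms
    by (intro L2_set_mono) (auto intro: norm_triangle_ineq)
  also have "\<dots> \<le> frob_norm A + frob_norm B"
    unfolding frob_norm_eq_L2_set[OF assms(1)] frob_norm_eq_L2_set[OF assms(2)]
    by (rule L2_set_triangle_ineq)
  finally show ?thesis .
qed

lemma frob_norm_smult: "frob_norm (c \<cdot>\<^sub>m A) = cmod c * frob_norm A"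
proof -
  have "(\<Sum>i<dim_row A. \<Sum>j<dim_col A. (cmod ((c \<cdot>\<^sub>m A) $$ (i, j)))\<^sup>2)
      = (cmod c)\<^sup>2 * (\<Sum>i<dim_row A. \<Sum>j<dim_col A. (cmod (A $$ (i, j)))\<^sup>2)"
    by (simp add: sum_distrib_left norm_mult power_mult_distrib)
  then show ?thesis by (simp add: frob_norm_def real_sqrt_mult)
qed

lemma frob_norm_nonneg: "0 \<le> frob_norm A"
  by (simp add: frob_norm_def sum_nonneg)

lemma rank_one_density:
  assumes "(\<Sum>a<n. cnj (u a) * u a) = 1"
  shows "Matrix.mat n n (\<lambda>(a, b). u a * cnj (u b)) \<in> density_mats n"
proof -
  let ?P = "Matrix.mat n n (\<lambda>(a, b). u a * cnj (u b))"
  have "0 \<le> Re (\<Sum>i<n. cnj (v $ i) * (?P *\<^sub>v v) $ i)" if v: "v \<in> carrier_vec n" for v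
  proof -
    \<comment> \<open>The quadratic form at \<open>v\<close> is \<open>cnj z * z\<close>, the
      squared modulus of an inner product.\<close>
    define z where "z = (\<Sum>j<n. cnj (u j) * v $ j)"
    have Pv: "(?P *\<^sub>v v) $ i = u i * z" if "i < n" for i
      using that v by (simp add: scalar_prod_def atLeast0LessThan z_def sum_distrib_left mult_ac)
    have "(\<Sum>i<n. cnj (v $ i) * (?P *\<^sub>v v) $ i) = (\<Sum>i<n. cnj (v $ i) * (u i * z))"
      by (intro sum.cong refl) (simp only: lessThan_iff Pv)
    also have "\<dots> = (\<Sum>i<n. cnj (v $ i) * u i) * z"
      by (simp add: sum_distrib_right mult.assoc)
    also have "(\<Sum>i<n. cnj (v $ i) * u i) = cnj z"
      by (simp add: z_def cnj_sum mult.commute)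
    finally show ?thesis by simp
  qed
  moreover have "mtrace ?P = 1"
    using assms by (simp add: mtrace_def mult.commute)
  moreover have "hermitian_mat n ?P" by (simp add: hermitian_mat_def)
  ultimately show ?thesis by (simp add: density_mats_def psd_mat_def)
qed

subsection \<open>Quantum channels\<close>

text \<open>Positivity of the image is complete positivity at \<open>k = 1\<close>, where
  \<open>block_apply\<close> reproduces \<open>\<Phi> \<rho>\<close>.\<close>

lemma channel_density:
  assumes ch: "quantum_channel m n \<Phi>" and \<rho>: "\<rho> \<in> density_mats m"
  shows "\<Phi> \<rho> \<in> density_mats n"
proof -
  have psd: "psd_mat m \<rho>" and tr: "mtrace \<rho> = 1" using \<rho> by (auto simp: density_mats_def)
  have c: "\<rho> \<in> carrier_mat m m" using psd by (simp add: psd_mat_def hermitian_mat_iff_adjoint)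
  have \<Phi>c: "\<Phi> \<rho> \<in> carrier_mat n n" and \<Phi>t: "mtrace (\<Phi> \<rho>) = mtrace \<rho>"
    using ch c unfolding quantum_channel_def by blast+
  have "Matrix.mat m m (\<lambda>(i, j). \<rho> $$ (i, j)) = \<rho>" using c by (intro eq_matI) auto
  then have "block_apply 1 m n \<Phi> \<rho> = \<Phi> \<rho>"
    using \<Phi>c by (intro eq_matI) (auto simp: block_apply_def)
  moreover have "psd_mat (1 * n) (block_apply 1 m n \<Phi> \<rho>)"
    using ch psd unfolding quantum_channel_def by (metis mult_1)
  ultimately show ?thesis using \<Phi>t tr by (simp add: density_mats_def)
qed

lemma density_frob_norm_le_1:
  assumes "\<sigma> \<in> density_mats n"
  shows "frob_norm \<sigma> \<le> 1"
proof -
  define p where "p k = Re (eigvals \<sigma> ! k)" for k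
  note p = density_eigvals[OF assms, folded p_def]
  have "p k \<le> 1" if "k < n" for k
    using member_le_sum[of k "{..<n}" p] that p(2,3) by simp
  then have "(\<Sum>k<n. (p k)\<^sup>2) \<le> (\<Sum>k<n. p k)"
    using p(2) by (intro sum_mono) (simp add: power2_eq_square mult_left_le)
  then have "(frob_norm \<sigma>)\<^sup>2 \<le> 1\<^sup>2" using p(3,4) by simp
  then show ?thesis by (rule power2_le_imp_le) simp
qed

text \<open>Expand \<open>\<rho>\<close> in its rank-one spectral projections, each a density
  matrix; linearity and the triangle inequality then weight \<open>M\<close> by the moduli of the
  eigenvalues.\<close>

lemma channel_frob_norm_le:
  assumes ch: "quantum_channel m n \<Phi>" and her: "hermitian_mat m \<rho>"
    and M: "\<And>\<rho>. \<rho> \<in> density_mats m \<Longrightarrow> frob_norm (\<Phi> \<rho>) \<le> M"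
  shows "frob_norm (\<Phi> \<rho>) \<le> M * trace_norm \<rho>"
proof -
  obtain U D where U: "U \<in> carrier_mat m m" "mat_adjoint U * U = 1\<^sub>m m"
    and D: "D = mat_diag m (\<lambda>i. eigvals \<rho> ! i)" and \<rho>: "\<rho> = U * D * mat_adjoint U"
    by (rule hermitian_eigvals[OF her])
  have c: "\<rho> \<in> carrier_mat m m" using her by (simp add: hermitian_mat_iff_adjoint)
  define P where "P k = Matrix.mat m m (\<lambda>(a, b). U $$ (a, k) * cnj (U $$ (b, k)))" for k
  \<comment> \<open>Partial sums of the spectral expansion, given entrywise; linearity is applied to
    one new term at a time.\<close>
  define R where "R K = Matrix.mat m m (\<lambda>(a, b).
    \<Sum>k<K. eigvals \<rho> ! k * (U $$ (a, k) * cnj (U $$ (b, k))))" for K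
  have Pc: "P k \<in> carrier_mat m m" and Rc: "R k \<in> carrier_mat m m" for k
    by (simp_all add: P_def R_def)
  have P: "P k \<in> density_mats m" if "k < m" for k
    unfolding P_def by (rule rank_one_density[OF unitary_col_norm[OF U that]])
  have add: "\<Phi> (A + B) = \<Phi> A + \<Phi> B" and smult: "\<Phi> (z \<cdot>\<^sub>m A) = z \<cdot>\<^sub>m \<Phi> A"
    and \<Phi>c: "\<Phi> A \<in> carrier_mat n n"
    if "A \<in> carrier_mat m m" "B \<in> carrier_mat m m" for A B and z :: complex
    using ch that unfolding quantum_channel_def by blast+
  have R_bound: "frob_norm (\<Phi> (R K)) \<le> M * (\<Sum>k<K. cmod (eigvals \<rho> ! k))" if "K \<le> m" for K
    using that
  proof (induction K)
    case 0
    \<comment> \<open>\<open>R 0\<close> is the zero matrix; written as 0 times itself it has an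
      image of norm 0 by homogeneity.\<close>
    have "R 0 = 0 \<cdot>\<^sub>m R 0" by (intro eq_matI) (auto simp: R_def)
    then have "\<Phi> (R 0) = 0 \<cdot>\<^sub>m \<Phi> (R 0)" using smult[OF Rc Rc, of 0 0] by metis
    then have "frob_norm (\<Phi> (R 0)) = cmod 0 * frob_norm (\<Phi> (R 0))" using frob_norm_smult by metis
    then show ?case by simp
  next
    case (Suc K)
    have "R (Suc K) = R K + (eigvals \<rho> ! K) \<cdot>\<^sub>m P K"
      by (intro eq_matI) (auto simp: R_def P_def)
    then have "\<Phi> (R (Suc K)) = \<Phi> (R K) + (eigvals \<rho> ! K) \<cdot>\<^sub>m \<Phi> (P K)"
      using add[of "R K" "(eigvals \<rho> ! K) \<cdot>\<^sub>m P K"] smult[of "P K" "P K"] Rc Pc by simp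
    moreover have "\<Phi> (R K) \<in> carrier_mat n n" "\<Phi> (P K) \<in> carrier_mat n n"
      using \<Phi>c Rc Pc by blast+
    ultimately have "frob_norm (\<Phi> (R (Suc K)))
        \<le> frob_norm (\<Phi> (R K)) + cmod (eigvals \<rho> ! K) * frob_norm (\<Phi> (P K))"
      using frob_norm_triangle[of "\<Phi> (R K)" n n "(eigvals \<rho> ! K) \<cdot>\<^sub>m \<Phi> (P K)"]
      by (simp add: frob_norm_smult)
    also have "\<dots> \<le> M * (\<Sum>k<K. cmod (eigvals \<rho> ! k)) + cmod (eigvals \<rho> ! K) * M"
      using Suc P[of K] by (intro add_mono mult_left_mono M) auto
    finally show ?case by (simp add: algebra_simps)
  qed
  have "\<rho> = R m"
  proof (rule eq_matI)
    fix a b assume "a < dim_row (R m)" "b < dim_col (R m)"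
    then have ab: "a < m" "b < m" by (simp_all add: R_def)
    have "\<rho> $$ (a, b) = (\<Sum>k<m. (\<Sum>l<m. U $$ (a, l) * D $$ (l, k)) * cnj (U $$ (b, k)))"
      using ab U(1) by (subst \<rho>) (simp add: D mat_diag_def scalar_prod_def atLeast0LessThan)
    also have "\<dots> = R m $$ (a, b)"
      using ab by (simp add: R_def D mat_diag_def if_distrib mult_ac cong: if_cong)
    finally show "\<rho> $$ (a, b) = R m $$ (a, b)" .
  qed (use c in \<open>auto simp: R_def\<close>)
  moreover have "trace_norm \<rho> = (\<Sum>k<m. cmod (eigvals \<rho> ! k))"
    by (simp add: trace_norm_def sum_list_sum_nth eigvals(1)[OF c] atLeast0LessThan)
  ultimately show ?thesis using R_bound[of m] by simp
qed

lemma density_mats_nonempty: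
  assumes "0 < m"
  shows "density_mats m \<noteq> {}"
proof -
  have "(\<Sum>a<m. cnj (if a = 0 then 1 else 0) * (if a = 0 then 1 else 0 :: complex)) = 1"
    using assms by (simp add: if_distrib cong: if_cong)
  from rank_one_density[OF this] show ?thesis by blast
qed

text \<open>Together the two facts say that the norm is the supremum over density matrices: these
  occur among the quotients with trace norm 1, and \<open>channel_frob_norm_le\<close> extends any
  bound on them to all Hermitian matrices.\<close>

lemma norm_1_2_channel:
  assumes m: "0 < m" and ch: "quantum_channel m n \<Phi>"
  shows "\<And>\<rho>. \<rho> \<in> density_mats m \<Longrightarrow> frob_norm (\<Phi> \<rho>) \<le> norm_1_2 m \<Phi>"
    and "\<And>M. (\<And>\<rho>. \<rho> \<in> density_mats m \<Longrightarrow> frob_norm (\<Phi> \<rho>) \<le> M) \<Longrightarrow> norm_1_2 m \<Phi> \<le> M"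
proof -
  let ?S = "{frob_norm (\<Phi> \<rho>) / trace_norm \<rho> | \<rho>. hermitian_mat m \<rho> \<and> \<rho> \<noteq> 0\<^sub>m m m}"
  obtain \<rho>0 where \<rho>0: "\<rho>0 \<in> density_mats m" using density_mats_nonempty[OF m] by blast
  have S: "frob_norm (\<Phi> \<rho>) \<in> ?S" if "\<rho> \<in> density_mats m" for \<rho>
  proof -
    have "mtrace (0\<^sub>m m m) = 0" by (simp add: mtrace_def)
    then have "\<rho> \<noteq> 0\<^sub>m m m" using that by (auto simp: density_mats_def)
    moreover have "hermitian_mat m \<rho>" using that by (simp add: density_mats_def psd_mat_def)
    ultimately show ?thesis
      using density_eigvals(5)[OF that] by (intro CollectI exI[of _ \<rho>] conjI) simp_all
  qed
  have le: "x \<le> M" if M: "\<And>\<rho>. \<rho> \<in> density_mats m \<Longrightarrow> frob_norm (\<Phi> \<rho>) \<le> M" and x: "x \<in> ?S" for x M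
  proof -
    obtain \<rho> where \<rho>: "hermitian_mat m \<rho>" "x = frob_norm (\<Phi> \<rho>) / trace_norm \<rho>" using x by blast
    have M0: "0 \<le> M" using M[OF \<rho>0] frob_norm_nonneg[of "\<Phi> \<rho>0"] by linarith
    have "0 \<le> trace_norm \<rho>" by (auto simp: trace_norm_def intro!: sum_list_nonneg)
    \<comment> \<open>For trace norm 0 the quotient is 0 by the convention for division, and
      \<open>0 \<le> M\<close> comes from the density matrix \<open>\<rho>0\<close>.\<close>
    then show ?thesis
      using channel_frob_norm_le[OF ch \<rho>(1) M] M0 \<rho>(2)
      by (cases "trace_norm \<rho> = 0") (auto simp: divide_le_eq)
  qed
  have "frob_norm (\<Phi> \<rho>) \<le> 1" if "\<rho> \<in> density_mats m" for \<rho>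
    by (rule density_frob_norm_le_1[OF channel_density[OF ch that]])
  then have bdd: "bdd_above ?S" using le by (intro bdd_aboveI[of _ 1]) blast
  show "frob_norm (\<Phi> \<rho>) \<le> norm_1_2 m \<Phi>" if "\<rho> \<in> density_mats m" for \<rho>
    unfolding norm_1_2_def by (rule cSup_upper[OF S[OF that] bdd])
  show "norm_1_2 m \<Phi> \<le> M" if "\<And>\<rho>. \<rho> \<in> density_mats m \<Longrightarrow> frob_norm (\<Phi> \<rho>) \<le> M" for M
    unfolding norm_1_2_def
  proof (rule cSup_least)
    show "?S \<noteq> {}" using S[OF \<rho>0] by blast
  qed (rule le[OF that])
qed

section \<open>Entropy bound for channels and equality for qubit outputs\<close>

lemma g_fun_le_renyi_channel:
  assumes m: "0 < m" and ch: "quantum_channel m n \<Phi>" and \<alpha>: "1 \<le> \<alpha>" "\<alpha> < 2"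
    and \<rho>: "\<rho> \<in> density_mats m"
  shows "g_fun \<alpha> ((norm_1_2 m \<Phi>)\<^sup>2) \<le> renyi \<alpha> (\<Phi> \<rho>)"
proof -
  have \<sigma>: "\<Phi> \<rho> \<in> density_mats n" by (rule channel_density[OF ch \<rho>])
  have "frob_norm (\<Phi> \<rho>) \<le> norm_1_2 m \<Phi>" by (rule norm_1_2_channel(1)[OF m ch \<rho>])
  then have 1: "(frob_norm (\<Phi> \<rho>))\<^sup>2 \<le> (norm_1_2 m \<Phi>)\<^sup>2" "0 \<le> norm_1_2 m \<Phi>"
    using frob_norm_nonneg[of "\<Phi> \<rho>"] by (auto intro: power_mono)
  have "norm_1_2 m \<Phi> \<le> 1"
  proof (rule norm_1_2_channel(2)[OF m ch])
    fix \<rho> assume "\<rho> \<in> density_mats m"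
    then show "frob_norm (\<Phi> \<rho>) \<le> 1" by (rule density_frob_norm_le_1[OF channel_density[OF ch]])
  qed
  then have "(norm_1_2 m \<Phi>)\<^sup>2 \<le> 1" using 1(2) by (simp add: power_le_one)
  then show ?thesis
    unfolding density_eigvals(6)[OF \<sigma>] using density_eigvals(2-4)[OF \<sigma>] 1(1) \<alpha>
    by (intro g_fun_le_entropy_of) auto
qed

lemma renyi_qubit:
  assumes "\<sigma> \<in> density_mats 2"
  shows "renyi \<alpha> \<sigma> = qubit_entropy \<alpha> ((frob_norm \<sigma>)\<^sup>2)" and "1 / 2 \<le> (frob_norm \<sigma>)\<^sup>2"
proof -
  define p where "p k = Re (eigvals \<sigma> ! k)" for k
  note p = density_eigvals[OF assms, folded p_def]
  have "{..<2} = {0, 1::nat}" by auto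
  then have p1: "p 0 + p 1 = 1" and p2: "(p 0)\<^sup>2 + (p 1)\<^sup>2 = (frob_norm \<sigma>)\<^sup>2"
    using p(3,4) by simp_all
  show "renyi \<alpha> \<sigma> = qubit_entropy \<alpha> ((frob_norm \<sigma>)\<^sup>2)"
    using p(6) entropy_of_two_eq_qubit_entropy[of p, OF p1] p2 by simp
  \<comment> \<open>The two squares add up to twice the purity, which is therefore at least
    \<open>1 / 2\<close>.\<close>
  have "0 \<le> (p 0 - p 1)\<^sup>2" "(p 0 + p 1)\<^sup>2 = 1" using p1 by auto
  then show "1 / 2 \<le> (frob_norm \<sigma>)\<^sup>2"
    unfolding p2[symmetric] by (simp add: power2_eq_square algebra_simps)
qed

theorem theorem6:
  fixes \<Phi> :: "complex mat \<Rightarrow> complex mat" and m n :: nat and \<alpha> :: real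
  assumes "0 < m" and "quantum_channel m n \<Phi>" and "1 \<le> \<alpha>" and "\<alpha> < 2"
  shows "min_renyi m \<alpha> \<Phi> \<ge> g_fun \<alpha> ((norm_1_2 m \<Phi>)^2) \<and>
         (n = 2 \<longrightarrow> min_renyi m \<alpha> \<Phi> = g_fun \<alpha> ((norm_1_2 m \<Phi>)^2))"
proof (intro conjI impI)
  let ?N = "norm_1_2 m \<Phi>"
  note bound = g_fun_le_renyi_channel[OF assms]
  note ne = density_mats_nonempty[OF assms(1)]
  show lower: "g_fun \<alpha> (?N^2) \<le> min_renyi m \<alpha> \<Phi>"
    unfolding min_renyi_def by (rule cINF_greatest[OF ne bound])
  assume n: "n = 2"
  \<comment> \<open>A sequence of states takes the place of a maximiser: the norm is a least upper
    bound, so for each \<open>j\<close> some state comes within \<open>1 / (j + 1)\<close> of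
    it.\<close>
  have ex: "\<exists>\<rho>\<in>density_mats m. ?N - 1 / real (Suc j) < frob_norm (\<Phi> \<rho>)" for j
  proof (rule ccontr)
    assume "\<not> ?thesis"
    then have "?N \<le> ?N - 1 / real (Suc j)"
      by (intro norm_1_2_channel(2)[OF assms(1,2)]) (auto simp: not_less)
    then show False by simp
  qed
  then have "\<forall>j. \<exists>\<rho>. \<rho> \<in> density_mats m \<and> ?N - 1 / real (Suc j) < frob_norm (\<Phi> \<rho>)" by blast
  from choice[OF this] obtain \<rho> where \<rho>: "\<And>j. \<rho> j \<in> density_mats m"
    and \<rho>N: "\<And>j. ?N - 1 / real (Suc j) < frob_norm (\<Phi> (\<rho> j))" by blast
  define c where "c j = (frob_norm (\<Phi> (\<rho> j)))\<^sup>2" for j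
  have \<sigma>: "\<Phi> (\<rho> j) \<in> density_mats 2" for j using channel_density[OF assms(2) \<rho>] n by simp
  have c: "c j \<in> {1 / 2..1}" for j
    using renyi_qubit(2)[OF \<sigma>] power_le_one[OF frob_norm_nonneg density_frob_norm_le_1[OF \<sigma>]]
    by (simp add: c_def)
  have "(\<lambda>j. ?N - 1 / real (Suc j)) \<longlonglongrightarrow> ?N - 0"
    by (rule tendsto_diff[OF tendsto_const LIMSEQ_Suc[OF lim_1_over_n]])
  then have to_N: "(\<lambda>j. ?N - 1 / real (Suc j)) \<longlonglongrightarrow> ?N" by simp
  have "(\<lambda>j. frob_norm (\<Phi> (\<rho> j))) \<longlonglongrightarrow> ?N"
  proof (rule tendsto_sandwich[OF _ _ to_N tendsto_const])
    show "\<forall>\<^sub>F j in sequentially. ?N - 1 / real (Suc j) \<le> frob_norm (\<Phi> (\<rho> j))"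
      by (rule always_eventually) (rule allI, rule less_imp_le[OF \<rho>N])
    show "\<forall>\<^sub>F j in sequentially. frob_norm (\<Phi> (\<rho> j)) \<le> ?N"
      by (rule always_eventually) (rule allI, rule norm_1_2_channel(1)[OF assms(1,2) \<rho>])
  qed
  then have lim: "c \<longlonglongrightarrow> ?N\<^sup>2" unfolding c_def by (rule tendsto_power)
  \<comment> \<open>Purities of qubit states fill at most a closed interval, so their limit stays
    where \<open>g_fun\<close> and \<open>qubit_entropy\<close> agree.\<close>
  then have N: "?N\<^sup>2 \<in> {1 / 2..1}"
    using closed_sequentially[of "{1 / 2..1}" c "?N\<^sup>2"] c by simp
  have lim_entropy: "(\<lambda>j. qubit_entropy \<alpha> (c j)) \<longlonglongrightarrow> qubit_entropy \<alpha> (?N\<^sup>2)"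
    using continuous_on_tendsto_compose[OF continuous_on_qubit_entropy[OF assms(3)] lim N] c by simp
  \<comment> \<open>\<open>bound\<close> also shows that the entropies are bounded below, so the
    infimum lies below each of them.\<close>
  have le: "min_renyi m \<alpha> \<Phi> \<le> qubit_entropy \<alpha> (c j)" for j
    unfolding c_def renyi_qubit(1)[OF \<sigma>, symmetric] min_renyi_def
    by (rule cINF_lower[OF bdd_belowI2[OF bound] \<rho>])
  have "min_renyi m \<alpha> \<Phi> \<le> qubit_entropy \<alpha> (?N\<^sup>2)"
    by (rule LIMSEQ_le_const[OF lim_entropy]) (use le in blast)
  also have "\<dots> = g_fun \<alpha> (?N\<^sup>2)"
    using g_fun_eq_qubit_entropy[OF assms(3)] N by simp
  finally show "min_renyi m \<alpha> \<Phi> = g_fun \<alpha> (?N^2)" using lower by simp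
qed

end
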